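(* Let $A$ be a small category and $\mathcal C$ a small contextual category. There exist isomorphisms of categories $$\mathbf{Hom}(\mathcal B,\mathcal C^A)\;\cong\;\mathbf{Hom}(\mathcal B,\mathcal C)^A$$ natural in $\mathcal B\in\mathrm{Cont}$, where $\mathcal C^A$ is the contextual category described in the context and $\mathbf{Hom}(\mathcal B,\mathcal C)^A$ is the category of functors $A\to\mathbf{Hom}(\mathcal B,\mathcal C)$.
   Context: A precontextual category $\mathcal C$ consists of: a category $|\mathcal C|$ (with a set of objects); a length function $\ell$ from objects to $\mathbb N$; a function $\partial$ from objects to objects with $\ell(\partial a)=\ell(a)-1$ if $\ell(a)\ge 1$ and $\partial a=a$ if $\ell(a)=0$; for each object $a$ with $\ell(a)\ge1$ a morphism $\mathbf p_a:a\to\partial a$ (a length-1 display map); and a set $\mathbf Q$ of commutative squares in $|\mathcal C|$ (length-1 distinguished squares) having left side some $\mathbf p_a$ and right side some $\mathbf p_b$. It is a contextual category if moreover: there is a unique object $1_{\mathcal C}$ of length $0$, and it is terminal; every element of $\mathbf Q$ is a pullback square; $\mathbf Q$ contains the identity square of every $\mathbf p_a$ and is closed under horizontal composition; for every $a$ with $\ell(a)\ge 1$ and every $f:b\to\partial a$ there is a unique element of $\mathbf Q$ with right side $\mathbf p_a$ and bottom side $f$. A morphism (contextual functor) is a functor strictly preserving $\ell,\partial,\mathbf p$ and sending elements of $\mathbf Q$ to elements of $\mathbf Q$. $\mathrm{Cont}$ is the category of small contextual categories and contextual functors; $\mathbf{Hom}(\mathcal B,\mathcal C)$ is the category of contextual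 functors $\mathcal B\to\mathcal C$ and all natural transformations between them. For a small category $A$ and contextual category $\mathcal C$, the contextual category $\mathcal C^A$ is: length-$n$ objects are sequences $(F_0,\dots,F_n)$ of functors $A\to|\mathcal C|$ such that $F_0$ is constant at $1_{\mathcal C}$ and, for $1\le i\le n$, $\ell(F_i(a))=i$, $\partial(F_i(a))=F_{i-1}(a)$ for all $a$, and the display maps $\mathbf p_{F_i(a)}:F_i(a)\to F_{i-1}(a)$ form a natural transformation $F_i\Rightarrow F_{i-1}$; morphisms $(F_0,\dots,F_m)\to(G_0,\dots,G_n)$ are natural transformations $F_m\Rightarrow G_n$; for $n\ge 1$, $\partial(F_0,\dots,F_n)=(F_0,\dots,F_{n-1})$ with display map the natural transformation $F_n\Rightarrow F_{n-1}$ whose $a$-component is $\mathbf p_{F_n(a)}:F_n(a)\to F_{n-1}(a)$ for each $a\in A$; a square between length-1 display maps is in $\mathbf Q$ iff for every $a\in A$ its square of $a$-components is in $\mathbf Q$ of $\mathcal C$. *)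

theory Defs
  imports Main "HOL-Library.FuncSet"
begin

section \<open>Categories, functors, natural transformations\<close>

text \<open>\<open>Comp K g f\<close> is the composite of first \<open>f\<close>, then \<open>g\<close>.\<close>

record ('o, 'm) cat =
  Obj :: "'o set"
  Arr :: "'m set"
  Dom :: "'m \<Rightarrow> 'o"
  Cod :: "'m \<Rightarrow> 'o"
  Id :: "'o \<Rightarrow> 'm"
  Comp :: "'m \<Rightarrow> 'm \<Rightarrow> 'm" (infixl \<open>\<cdot>\<index>\<close> 70)

definition hom :: "('o, 'm, 'x) cat_scheme \<Rightarrow> 'o \<Rightarrow> 'o \<Rightarrow> 'm set" where
  "hom K x y = {f \<in> Arr K. Dom K f = x \<and> Cod K f = y}"

locale category =
  fixes K :: "('o, 'm, 'x) cat_scheme" (structure)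
  assumes Dom_Obj: "f \<in> Arr K \<Longrightarrow> Dom K f \<in> Obj K"
    and Cod_Obj: "f \<in> Arr K \<Longrightarrow> Cod K f \<in> Obj K"
    and Id_hom: "x \<in> Obj K \<Longrightarrow> Id K x \<in> hom K x x"
    and Comp_hom: "f \<in> hom K x y \<Longrightarrow> g \<in> hom K y z \<Longrightarrow> g \<cdot> f \<in> hom K x z"
    and Comp_Id: "f \<in> hom K x y \<Longrightarrow> f \<cdot> Id K x = f"
    and Id_Comp: "f \<in> hom K x y \<Longrightarrow> Id K y \<cdot> f = f"
    and Comp_assoc: "f \<in> hom K w x \<Longrightarrow> g \<in> hom K x y \<Longrightarrow> h \<in> hom K y z
      \<Longrightarrow> h \<cdot> (g \<cdot> f) = (h \<cdot> g) \<cdot> f"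

definition terminal :: "('o, 'm, 'x) cat_scheme \<Rightarrow> 'o \<Rightarrow> bool" where
  "terminal K x \<longleftrightarrow> x \<in> Obj K \<and> (\<forall>y\<in>Obj K. \<exists>!f. f \<in> hom K y x)"

text \<open>
  Functors and families of components are required to be extensional (\<open>undefined\<close>
  outside the objects, resp. arrows, of the source category), so that equality of the
  representing records is equality of functors, resp. of natural transformations.
\<close>

record ('a, 'am, 'c, 'cm) func =
  omap :: "'a \<Rightarrow> 'c"
  amap :: "'am \<Rightarrow> 'cm"

definition is_functor ::
  "('a, 'am, 'x) cat_scheme \<Rightarrow> ('c, 'cm, 'y) cat_scheme \<Rightarrow> ('a, 'am, 'c, 'cm) func \<Rightarrow> bool" where
  "is_functor K L F \<longleftrightarrow>
     omap F \<in> Obj K \<rightarrow>\<^sub>E Obj L \<and>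
     amap F \<in> Arr K \<rightarrow>\<^sub>E Arr L \<and>
     (\<forall>f\<in>Arr K. amap F f \<in> hom L (omap F (Dom K f)) (omap F (Cod K f))) \<and>
     (\<forall>x\<in>Obj K. amap F (Id K x) = Id L (omap F x)) \<and>
     (\<forall>f\<in>Arr K. \<forall>g\<in>Arr K. Cod K f = Dom K g \<longrightarrow>
        amap F (g \<cdot>\<^bsub>K\<^esub> f) = amap F g \<cdot>\<^bsub>L\<^esub> amap F f)"

definition id_func :: "('a, 'am, 'x) cat_scheme \<Rightarrow> ('a, 'am, 'a, 'am) func" where
  "id_func K = \<lparr>omap = (\<lambda>x\<in>Obj K. x), amap = (\<lambda>f\<in>Arr K. f)\<rparr>"

definition comp_func :: "('a, 'am, 'x) cat_scheme \<Rightarrow> ('b, 'bm, 'c, 'cm) func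
    \<Rightarrow> ('a, 'am, 'b, 'bm) func \<Rightarrow> ('a, 'am, 'c, 'cm) func" where
  "comp_func K G F =
     \<lparr>omap = compose (Obj K) (omap G) (omap F), amap = compose (Arr K) (amap G) (amap F)\<rparr>"

definition const_func ::
  "('a, 'am, 'x) cat_scheme \<Rightarrow> ('c, 'cm, 'y) cat_scheme \<Rightarrow> 'c \<Rightarrow> ('a, 'am, 'c, 'cm) func" where
  "const_func K L x = \<lparr>omap = (\<lambda>_\<in>Obj K. x), amap = (\<lambda>_\<in>Arr K. Id L x)\<rparr>"

definition cat_iso ::
  "('a, 'am, 'x) cat_scheme \<Rightarrow> ('c, 'cm, 'y) cat_scheme \<Rightarrow> ('a, 'am, 'c, 'cm) func \<Rightarrow> bool" where
  "cat_iso K L F \<longleftrightarrow> is_functor K L F \<and>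
     (\<exists>G. is_functor L K G \<and> comp_func K G F = id_func K \<and> comp_func L F G = id_func L)"

record ('a, 'am, 'c, 'cm) nt =
  NDom :: "('a, 'am, 'c, 'cm) func"
  NCod :: "('a, 'am, 'c, 'cm) func"
  cpt :: "'a \<Rightarrow> 'cm"

definition is_nt ::
  "('a, 'am, 'x) cat_scheme \<Rightarrow> ('c, 'cm, 'y) cat_scheme \<Rightarrow> ('a, 'am, 'c, 'cm) nt \<Rightarrow> bool" where
  "is_nt K L \<tau> \<longleftrightarrow>
     is_functor K L (NDom \<tau>) \<and> is_functor K L (NCod \<tau>) \<and>
     cpt \<tau> \<in> extensional (Obj K) \<and>
     (\<forall>x\<in>Obj K. cpt \<tau> x \<in> hom L (omap (NDom \<tau>) x) (omap (NCod \<tau>) x)) \<and>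
     (\<forall>f\<in>Arr K. amap (NCod \<tau>) f \<cdot>\<^bsub>L\<^esub> cpt \<tau> (Dom K f) = cpt \<tau> (Cod K f) \<cdot>\<^bsub>L\<^esub> amap (NDom \<tau>) f)"

definition id_nt :: "('a, 'am, 'x) cat_scheme \<Rightarrow> ('c, 'cm, 'y) cat_scheme
    \<Rightarrow> ('a, 'am, 'c, 'cm) func \<Rightarrow> ('a, 'am, 'c, 'cm) nt" where
  "id_nt K L F = \<lparr>NDom = F, NCod = F, cpt = (\<lambda>x\<in>Obj K. Id L (omap F x))\<rparr>"

definition comp_nt :: "('a, 'am, 'x) cat_scheme \<Rightarrow> ('c, 'cm, 'y) cat_scheme
    \<Rightarrow> ('a, 'am, 'c, 'cm) nt \<Rightarrow> ('a, 'am, 'c, 'cm) nt \<Rightarrow> ('a, 'am, 'c, 'cm) nt" where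
  "comp_nt K L \<sigma> \<tau> =
     \<lparr>NDom = NDom \<tau>, NCod = NCod \<sigma>, cpt = (\<lambda>x\<in>Obj K. cpt \<sigma> x \<cdot>\<^bsub>L\<^esub> cpt \<tau> x)\<rparr>"

text \<open>The full subcategory, on a set \<open>X\<close> of functors, of the category of functors from
  \<open>K\<close> to \<open>L\<close>.\<close>

definition func_cat_on :: "('a, 'am, 'c, 'cm) func set \<Rightarrow> ('a, 'am, 'x) cat_scheme
    \<Rightarrow> ('c, 'cm, 'y) cat_scheme \<Rightarrow> (('a, 'am, 'c, 'cm) func, ('a, 'am, 'c, 'cm) nt) cat" where
  "func_cat_on X K L =
     \<lparr>Obj = X,
      Arr = {\<tau>. is_nt K L \<tau> \<and> NDom \<tau> \<in> X \<and> NCod \<tau> \<in> X},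
      Dom = NDom,
      Cod = NCod,
      Id = id_nt K L,
      Comp = comp_nt K L\<rparr>"

definition func_cat :: "('a, 'am, 'x) cat_scheme \<Rightarrow> ('c, 'cm, 'y) cat_scheme
    \<Rightarrow> (('a, 'am, 'c, 'cm) func, ('a, 'am, 'c, 'cm) nt) cat" where
  "func_cat K L = func_cat_on {F. is_functor K L F} K L"

text \<open>For \<open>P\<close> from \<open>L\<close> to \<open>M\<close>, the induced functor from \<open>func_cat K L\<close> to \<open>func_cat K M\<close>.\<close>

definition postcomp :: "('a, 'am, 'x) cat_scheme \<Rightarrow> ('c, 'cm, 'y) cat_scheme
    \<Rightarrow> ('c, 'cm, 'd, 'dm) func
    \<Rightarrow> (('a, 'am, 'c, 'cm) func, ('a, 'am, 'c, 'cm) nt,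
        ('a, 'am, 'd, 'dm) func, ('a, 'am, 'd, 'dm) nt) func" where
  "postcomp K L P =
     \<lparr>omap = (\<lambda>F\<in>Obj (func_cat K L). comp_func K P F),
      amap = (\<lambda>\<tau>\<in>Arr (func_cat K L).
        \<lparr>NDom = comp_func K P (NDom \<tau>), NCod = comp_func K P (NCod \<tau>),
         cpt = (\<lambda>x\<in>Obj K. amap P (cpt \<tau> x))\<rparr>)\<rparr>"


section \<open>Contextual categories\<close>

datatype 'm square =
  Square (top_side: 'm) (left_side: 'm) (right_side: 'm) (bottom_side: 'm)

definition commutative_square :: "('o, 'm, 'x) cat_scheme \<Rightarrow> 'm square \<Rightarrow> bool" where
  "commutative_square K s \<longleftrightarrow>
     (\<exists>w x y z. top_side s \<in> hom K w x \<and> left_side s \<in> hom K w y \<and>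
        right_side s \<in> hom K x z \<and> bottom_side s \<in> hom K y z) \<and>
     right_side s \<cdot>\<^bsub>K\<^esub> top_side s = bottom_side s \<cdot>\<^bsub>K\<^esub> left_side s"

definition pullback_square :: "('o, 'm, 'x) cat_scheme \<Rightarrow> 'm square \<Rightarrow> bool" where
  "pullback_square K s \<longleftrightarrow> commutative_square K s \<and>
     (\<forall>v. \<forall>f\<in>hom K v (Cod K (top_side s)). \<forall>g\<in>hom K v (Cod K (left_side s)).
        right_side s \<cdot>\<^bsub>K\<^esub> f = bottom_side s \<cdot>\<^bsub>K\<^esub> g \<longrightarrow>
        (\<exists>!h. h \<in> hom K v (Dom K (top_side s)) \<and>
           top_side s \<cdot>\<^bsub>K\<^esub> h = f \<and> left_side s \<cdot>\<^bsub>K\<^esub> h = g))"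

text \<open>
  \<open>len\<close>, \<open>ft\<close>, \<open>disp\<close> and \<open>dsq\<close> are the \<open>\<ell>\<close>, \<open>\<partial>\<close>, \<open>\<^bold>p\<close> and \<open>\<^bold>Q\<close> of a (pre)contextual
  category. The value \<open>disp C x\<close> is meaningful only if \<open>len C x \<ge> 1\<close>.
\<close>

record ('o, 'm) ctx = "('o, 'm) cat" +
  len :: "'o \<Rightarrow> nat"
  ft :: "'o \<Rightarrow> 'o"
  disp :: "'o \<Rightarrow> 'm"
  dsq :: "'m square set"

locale precontextual_category = category C
  for C :: "('o, 'm, 'x) ctx_scheme" (structure) +
  assumes ft_Obj: "x \<in> Obj C \<Longrightarrow> ft C x \<in> Obj C"
    and len_ft: "x \<in> Obj C \<Longrightarrow> len C x \<ge> 1 \<Longrightarrow> len C (ft C x) = len C x - 1"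
    and ft_len_0: "x \<in> Obj C \<Longrightarrow> len C x = 0 \<Longrightarrow> ft C x = x"
    and disp_hom: "x \<in> Obj C \<Longrightarrow> len C x \<ge> 1 \<Longrightarrow> disp C x \<in> hom C x (ft C x)"
    and dsq_commutative: "s \<in> dsq C \<Longrightarrow> commutative_square C s"
    and dsq_left: "s \<in> dsq C \<Longrightarrow> \<exists>x\<in>Obj C. len C x \<ge> 1 \<and> left_side s = disp C x"
    and dsq_right: "s \<in> dsq C \<Longrightarrow> \<exists>x\<in>Obj C. len C x \<ge> 1 \<and> right_side s = disp C x"

locale contextual_category = precontextual_category C
  for C :: "('o, 'm, 'x) ctx_scheme" (structure) +
  assumes ex1_len_0: "\<exists>!x. x \<in> Obj C \<and> len C x = 0"
    and len_0_terminal: "x \<in> Obj C \<Longrightarrow> len C x = 0 \<Longrightarrow> terminal C x"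
    and dsq_pullback: "s \<in> dsq C \<Longrightarrow> pullback_square C s"
    and dsq_identity: "x \<in> Obj C \<Longrightarrow> len C x \<ge> 1
      \<Longrightarrow> Square (Id C x) (disp C x) (disp C x) (Id C (ft C x)) \<in> dsq C"
    and dsq_horizontal: "Square t l m b \<in> dsq C \<Longrightarrow> Square t' m r b' \<in> dsq C
      \<Longrightarrow> Square (t' \<cdot> t) l r (b' \<cdot> b) \<in> dsq C"
    and dsq_lift: "x \<in> Obj C \<Longrightarrow> len C x \<ge> 1 \<Longrightarrow> f \<in> hom C y (ft C x)
      \<Longrightarrow> \<exists>!s. s \<in> dsq C \<and> right_side s = disp C x \<and> bottom_side s = f"

definition one :: "('o, 'm, 'x) ctx_scheme \<Rightarrow> 'o" where
  "one C = (THE x. x \<in> Obj C \<and> len C x = 0)"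

definition contextual_functor ::
  "('b, 'bm, 'x) ctx_scheme \<Rightarrow> ('c, 'cm, 'y) ctx_scheme \<Rightarrow> ('b, 'bm, 'c, 'cm) func \<Rightarrow> bool" where
  "contextual_functor B C F \<longleftrightarrow> is_functor B C F \<and>
     (\<forall>x\<in>Obj B. len C (omap F x) = len B x \<and> ft C (omap F x) = omap F (ft B x)) \<and>
     (\<forall>x\<in>Obj B. len B x \<ge> 1 \<longrightarrow> amap F (disp B x) = disp C (omap F x)) \<and>
     (\<forall>s\<in>dsq B. map_square (amap F) s \<in> dsq C)"

definition Hom :: "('b, 'bm, 'x) ctx_scheme \<Rightarrow> ('c, 'cm, 'y) ctx_scheme
    \<Rightarrow> (('b, 'bm, 'c, 'cm) func, ('b, 'bm, 'c, 'cm) nt) cat" where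
  "Hom B C = func_cat_on {F. contextual_functor B C F} B C"

text \<open>For a contextual functor \<open>G\<close> from \<open>B'\<close> to \<open>B\<close>: the induced functor from \<open>Hom B C\<close>
  to \<open>Hom B' C\<close>.\<close>

definition Hom_precomp :: "('b2, 'bm2, 'z) ctx_scheme \<Rightarrow> ('b, 'bm, 'x) ctx_scheme
    \<Rightarrow> ('c, 'cm, 'y) ctx_scheme \<Rightarrow> ('b2, 'bm2, 'b, 'bm) func
    \<Rightarrow> (('b, 'bm, 'c, 'cm) func, ('b, 'bm, 'c, 'cm) nt,
        ('b2, 'bm2, 'c, 'cm) func, ('b2, 'bm2, 'c, 'cm) nt) func" where
  "Hom_precomp B' B C G =
     \<lparr>omap = (\<lambda>F\<in>Obj (Hom B C). comp_func B' F G),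
      amap = (\<lambda>\<tau>\<in>Arr (Hom B C).
        \<lparr>NDom = comp_func B' (NDom \<tau>) G, NCod = comp_func B' (NCod \<tau>) G,
         cpt = (\<lambda>x\<in>Obj B'. cpt \<tau> (omap G x))\<rparr>)\<rparr>"


section \<open>The contextual category of diagrams\<close>

definition disp_nt :: "('a, 'am, 'x) cat_scheme \<Rightarrow> ('c, 'cm, 'y) ctx_scheme
    \<Rightarrow> ('a, 'am, 'c, 'cm) func \<Rightarrow> ('a, 'am, 'c, 'cm) func \<Rightarrow> ('a, 'am, 'c, 'cm) nt" where
  "disp_nt A C F G = \<lparr>NDom = F, NCod = G, cpt = (\<lambda>a\<in>Obj A. disp C (omap F a))\<rparr>"

text \<open>A sequence of functors indexed by \<open>0, \<dots>, n\<close> is a list of length \<open>n + 1\<close>.\<close>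

definition diagram_seq ::
  "('a, 'am, 'x) cat_scheme \<Rightarrow> ('c, 'cm, 'y) ctx_scheme \<Rightarrow> ('a, 'am, 'c, 'cm) func list \<Rightarrow> bool" where
  "diagram_seq A C Fs \<longleftrightarrow>
     Fs \<noteq> [] \<and> (\<forall>F\<in>set Fs. is_functor A C F) \<and> Fs ! 0 = const_func A C (one C) \<and>
     (\<forall>i. 1 \<le> i \<and> i < length Fs \<longrightarrow>
        (\<forall>a\<in>Obj A. len C (omap (Fs ! i) a) = i \<and>
           ft C (omap (Fs ! i) a) = omap (Fs ! (i - 1)) a) \<and>
        is_nt A C (disp_nt A C (Fs ! i) (Fs ! (i - 1))))"

text \<open>
  An arrow is a natural transformation between the last entries, tagged with its source
  and target sequences. The tags are needed: a sequence is not determined by its last entry,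
  since the earlier functors are not determined on arrows.
\<close>

type_synonym ('a, 'am, 'c, 'cm) diagram_arr =
  "('a, 'am, 'c, 'cm) func list \<times> ('a, 'am, 'c, 'cm) nt \<times> ('a, 'am, 'c, 'cm) func list"

definition diagram_cat :: "('a, 'am, 'x) cat_scheme \<Rightarrow> ('c, 'cm, 'y) ctx_scheme
    \<Rightarrow> (('a, 'am, 'c, 'cm) func list, ('a, 'am, 'c, 'cm) diagram_arr) cat" where
  "diagram_cat A C =
     \<lparr>Obj = {Fs. diagram_seq A C Fs},
      Arr = {(Fs, \<tau>, Gs). diagram_seq A C Fs \<and> diagram_seq A C Gs \<and> is_nt A C \<tau> \<and>
               NDom \<tau> = last Fs \<and> NCod \<tau> = last Gs},
      Dom = (\<lambda>(Fs, \<tau>, Gs). Fs),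
      Cod = (\<lambda>(Fs, \<tau>, Gs). Gs),
      Id = (\<lambda>Fs. (Fs, id_nt A C (last Fs), Fs)),
      Comp = (\<lambda>(Gs, \<sigma>, Hs) (Fs, \<tau>, Gs'). (Fs, comp_nt A C \<sigma> \<tau>, Hs))\<rparr>"

definition diagram_len :: "('a, 'am, 'c, 'cm) func list \<Rightarrow> nat" where
  "diagram_len Fs = length Fs - 1"

definition diagram_ft :: "('a, 'am, 'c, 'cm) func list \<Rightarrow> ('a, 'am, 'c, 'cm) func list" where
  "diagram_ft Fs = (if diagram_len Fs = 0 then Fs else butlast Fs)"

definition diagram_disp :: "('a, 'am, 'x) cat_scheme \<Rightarrow> ('c, 'cm, 'y) ctx_scheme
    \<Rightarrow> ('a, 'am, 'c, 'cm) func list \<Rightarrow> ('a, 'am, 'c, 'cm) diagram_arr" where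
  "diagram_disp A C Fs =
     (Fs, disp_nt A C (last Fs) (last (diagram_ft Fs)), diagram_ft Fs)"

definition diagram_cpt :: "'a \<Rightarrow> ('a, 'am, 'c, 'cm) diagram_arr \<Rightarrow> 'cm" where
  "diagram_cpt a = (\<lambda>(Fs, \<tau>, Gs). cpt \<tau> a)"

definition diagram_ctx :: "('a, 'am, 'x) cat_scheme \<Rightarrow> ('c, 'cm, 'y) ctx_scheme
    \<Rightarrow> (('a, 'am, 'c, 'cm) func list, ('a, 'am, 'c, 'cm) diagram_arr) ctx" where
  "diagram_ctx A C =
     \<lparr>Obj = Obj (diagram_cat A C),
      Arr = Arr (diagram_cat A C),
      Dom = Dom (diagram_cat A C),
      Cod = Cod (diagram_cat A C),
      Id = Id (diagram_cat A C),
      Comp = Comp (diagram_cat A C),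
      len = diagram_len,
      ft = diagram_ft,
      disp = diagram_disp A C,
      dsq = {s. commutative_square (diagram_cat A C) s \<and>
        (\<exists>Fs\<in>Obj (diagram_cat A C). diagram_len Fs \<ge> 1 \<and> left_side s = diagram_disp A C Fs) \<and>
        (\<exists>Gs\<in>Obj (diagram_cat A C). diagram_len Gs \<ge> 1 \<and> right_side s = diagram_disp A C Gs) \<and>
        (\<forall>a\<in>Obj A. map_square (diagram_cpt a) s \<in> dsq C)}\<rparr>"

end

theory Submission
  imports Defs
begin

text \<open>
  Evaluation of diagrams is a functor from \<open>A\<close> to \<open>Hom D C\<close>, where \<open>D\<close> is
  the contextual category of diagrams; precomposing it with a contextual functor
  \<open>\<Phi>\<close> from \<open>B\<close> to \<open>D\<close> gives the transpose of \<open>\<Phi>\<close>, which makes naturality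
  in \<open>B\<close> an instance of associativity. Conversely, a functor \<open>H\<close> from \<open>A\<close> to
  \<open>Hom B C\<close> determines for each object \<open>x\<close> of \<open>B\<close> a functor from \<open>A\<close> to \<open>C\<close>, its
  slice at \<open>x\<close>, and the diagram that corresponds to \<open>x\<close> is the sequence of slices at the
  iterated fathers of \<open>x\<close>. A contextual functor into \<open>D\<close> preserves fathers, which truncate
  sequences, so it is determined on objects by the last entries of its values; hence the two
  constructions are mutually inverse.
\<close>

section \<open>Functors and natural transformations\<close>

text \<open>Functors are extensional: off the objects and arrows of \<open>K\<close> both records
  take the value \<open>undefined\<close>, so agreement on \<open>K\<close> settles
  equality.\<close>

lemma func_eqI:
  assumes "is_functor K L F" "is_functor K L G"
    and "\<And>x. x \<in> Obj K \<Longrightarrow> omap F x = omap G x"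
    and "\<And>f. f \<in> Arr K \<Longrightarrow> amap F f = amap G f"
  shows "F = G"
proof (rule func.equality)
  show "omap F = omap G"
    using assms by (intro PiE_ext[of _ "Obj K" "\<lambda>_. Obj L"]) (auto simp: is_functor_def)
  show "amap F = amap G"
    using assms by (intro PiE_ext[of _ "Arr K" "\<lambda>_. Arr L"]) (auto simp: is_functor_def)
qed simp

lemma is_functor_Obj: "is_functor K L F \<Longrightarrow> x \<in> Obj K \<Longrightarrow> omap F x \<in> Obj L"
  by (auto simp: is_functor_def)

lemma is_functor_Arr: "is_functor K L F \<Longrightarrow> f \<in> Arr K \<Longrightarrow> amap F f \<in> Arr L"
  by (auto simp: is_functor_def)

lemma is_functor_hom: "is_functor K L F \<Longrightarrow> f \<in> hom K x y \<Longrightarrow> amap F f \<in> hom L (omap F x) (omap F y)"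
  by (auto simp: is_functor_def hom_def)

lemma is_functor_Id: "is_functor K L F \<Longrightarrow> x \<in> Obj K \<Longrightarrow> amap F (Id K x) = Id L (omap F x)"
  by (auto simp: is_functor_def)

lemma is_functor_Comp:
  "is_functor K L F \<Longrightarrow> f \<in> hom K x y \<Longrightarrow> g \<in> hom K y z \<Longrightarrow>
    amap F (g \<cdot>\<^bsub>K\<^esub> f) = amap F g \<cdot>\<^bsub>L\<^esub> amap F f"
  by (auto simp: is_functor_def hom_def)

lemma (in category) Arr_hom: "f \<in> Arr K \<Longrightarrow> f \<in> hom K (Dom K f) (Cod K f)"
  by (simp add: hom_def)

lemma is_functor_comp_func:
  assumes "category K" "is_functor K L F" "is_functor L M G"
  shows "is_functor K M (comp_func K G F)"
proof -
  interpret category K by fact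
  \<comment> \<open>\<open>compose\<close> returns \<open>undefined\<close> off
    \<open>Arr K\<close>, so identities and composites must be known to lie in \<open>Arr K\<close>
    before \<open>comp_func\<close> can be unfolded at them.\<close>
  have Id_Arr: "Id K x \<in> Arr K" if "x \<in> Obj K" for x
    using Id_hom[OF that] by (simp add: hom_def)
  have Comp_Arr: "g \<cdot>\<^bsub>K\<^esub> f \<in> Arr K" if "f \<in> Arr K" "g \<in> Arr K" "Cod K f = Dom K g" for f g
    using Comp_hom[of f _ _ g] that by (auto simp: hom_def)
  have "amap G (amap F f) \<in> hom M (omap G (omap F (Dom K f))) (omap G (omap F (Cod K f)))"
    if "f \<in> Arr K" for f
    using is_functor_hom[OF assms(3) is_functor_hom[OF assms(2) Arr_hom[OF that]]] .
  moreover have "amap G (amap F (g \<cdot>\<^bsub>K\<^esub> f)) = amap G (amap F g) \<cdot>\<^bsub>M\<^esub> amap G (amap F f)"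
    if "f \<in> Arr K" "g \<in> Arr K" "Cod K f = Dom K g" for f g
  proof -
    have *: "f \<in> hom K (Dom K f) (Dom K g)" "g \<in> hom K (Dom K g) (Cod K g)"
      using that by (auto simp: hom_def)
    show ?thesis
      using is_functor_Comp[OF assms(2) *]
        is_functor_Comp[OF assms(3) is_functor_hom[OF assms(2) *(1)] is_functor_hom[OF assms(2) *(2)]]
      by simp
  qed
  ultimately show ?thesis
    unfolding is_functor_def[of K M]
    using assms(2,3) Id_Arr Comp_Arr
    by (auto simp: comp_func_def compose_def Dom_Obj Cod_Obj is_functor_Id[OF assms(2)]
          is_functor_Id[OF assms(3)] is_functor_Obj[OF assms(2)]
        intro!: is_functor_Obj[OF assms(3)] is_functor_Arr[OF assms(3)]
          is_functor_Obj[OF assms(2)] is_functor_Arr[OF assms(2)])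
qed

text \<open>The inverse is given by bare maps on objects and arrows: \<open>GA\<close> being a left
  inverse makes \<open>F\<close> injective on arrows, which forces the inverse maps to respect
  identities and composites. This spares a functoriality proof for untransposition.\<close>

lemma cat_isoI:
  assumes "category K" "category L" and F: "is_functor K L F"
    and GO: "\<And>y. y \<in> Obj L \<Longrightarrow> GO y \<in> Obj K" "\<And>y. y \<in> Obj L \<Longrightarrow> omap F (GO y) = y"
      "\<And>x. x \<in> Obj K \<Longrightarrow> GO (omap F x) = x"
    and GA: "\<And>g. g \<in> Arr L \<Longrightarrow> GA g \<in> Arr K" "\<And>g. g \<in> Arr L \<Longrightarrow> amap F (GA g) = g"
      "\<And>f. f \<in> Arr K \<Longrightarrow> GA (amap F f) = f"
  shows "cat_iso K L F"
proof -
  interpret K: category K by fact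
  interpret L: category L by fact
  define G where "G = \<lparr>omap = (\<lambda>y\<in>Obj L. GO y), amap = (\<lambda>g\<in>Arr L. GA g)\<rparr>"
  \<comment> \<open>Source and target of \<open>GA g\<close> are found by applying \<open>F\<close>
    and cancelling with \<open>GO\<close>, a left inverse on objects.\<close>
  have GA_hom: "GA g \<in> hom K (GO (Dom L g)) (GO (Cod L g))" if g: "g \<in> Arr L" for g
  proof -
    have "amap F (GA g) \<in> hom L (omap F (Dom K (GA g))) (omap F (Cod K (GA g)))"
      using is_functor_hom[OF F K.Arr_hom[OF GA(1)[OF g]]] .
    then have "Dom L g = omap F (Dom K (GA g))" "Cod L g = omap F (Cod K (GA g))"
      by (auto simp: hom_def GA(2)[OF g])
    then show ?thesis
      using GA(1)[OF g] by (simp add: hom_def GO K.Dom_Obj K.Cod_Obj)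
  qed
  have G: "is_functor L K G"
    unfolding is_functor_def
  proof (intro conjI ballI impI)
    show "amap G f \<in> hom K (omap G (Dom L f)) (omap G (Cod L f))" if "f \<in> Arr L" for f
      using GA_hom[OF that] that by (simp add: G_def L.Dom_Obj L.Cod_Obj)
    show "amap G (Id L y) = Id K (omap G y)" if y: "y \<in> Obj L" for y
    proof -
      have "Id K (GO y) \<in> Arr K" "Id L y \<in> Arr L"
        using K.Id_hom[OF GO(1)[OF y]] L.Id_hom[OF y] by (auto simp: hom_def)
      \<comment> \<open>The expected value is pushed through \<open>F\<close> first, so that the
        left inverse law for \<open>GA\<close> applies; composites are treated in the same
        way.\<close>
      moreover have "amap F (Id K (GO y)) = Id L y"
        using is_functor_Id[OF F GO(1)[OF y]] by (simp add: GO(2) y)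
      ultimately show ?thesis
        using GA(3)[of "Id K (GO y)"] y by (simp add: G_def)
    qed
    show "amap G (g \<cdot>\<^bsub>L\<^esub> f) = amap G g \<cdot>\<^bsub>K\<^esub> amap G f"
      if f: "f \<in> Arr L" and g: "g \<in> Arr L" and "Cod L f = Dom L g" for f g
    proof -
      have f': "GA f \<in> hom K (GO (Dom L f)) (GO (Dom L g))" and g': "GA g \<in> hom K (GO (Dom L g)) (GO (Cod L g))"
        using GA_hom[OF f] GA_hom[OF g] that by auto
      have "GA g \<cdot>\<^bsub>K\<^esub> GA f \<in> Arr K"
        using K.Comp_hom[OF f' g'] by (simp add: hom_def)
      moreover have "g \<cdot>\<^bsub>L\<^esub> f \<in> Arr L"
        using L.Comp_hom[of f "Dom L f" "Dom L g" g "Cod L g"] that by (simp add: hom_def)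
      moreover have "amap F (GA g \<cdot>\<^bsub>K\<^esub> GA f) = g \<cdot>\<^bsub>L\<^esub> f"
        using is_functor_Comp[OF F f' g'] by (simp add: GA(2) f g)
      ultimately show ?thesis
        using GA(3)[of "GA g \<cdot>\<^bsub>K\<^esub> GA f"] f g by (simp add: G_def)
    qed
  qed (auto simp: G_def GO GA)
  have "comp_func K G F = id_func K" "comp_func L F G = id_func L"
    using F by (auto simp: comp_func_def id_func_def G_def compose_def GO GA fun_eq_iff
        is_functor_Obj is_functor_Arr)
  with F G show ?thesis
    by (auto simp: cat_iso_def)
qed

section \<open>Natural transformations and categories of functors\<close>

lemma is_nt_hom:
  "is_nt K L \<tau> \<Longrightarrow> x \<in> Obj K \<Longrightarrow> cpt \<tau> x \<in> hom L (omap (NDom \<tau>) x) (omap (NCod \<tau>) x)"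
  by (simp add: is_nt_def)

lemma is_nt_natural:
  "is_nt K L \<tau> \<Longrightarrow> f \<in> hom K x y \<Longrightarrow>
    amap (NCod \<tau>) f \<cdot>\<^bsub>L\<^esub> cpt \<tau> x = cpt \<tau> y \<cdot>\<^bsub>L\<^esub> amap (NDom \<tau>) f"
  by (auto simp: is_nt_def hom_def)

lemma nt_eqI:
  assumes "is_nt K L \<sigma>" "is_nt K L \<tau>" "NDom \<sigma> = NDom \<tau>" "NCod \<sigma> = NCod \<tau>"
    and "\<And>x. x \<in> Obj K \<Longrightarrow> cpt \<sigma> x = cpt \<tau> x"
  shows "\<sigma> = \<tau>"
proof (rule nt.equality)
  show "cpt \<sigma> = cpt \<tau>"
    using assms by (intro extensionalityI[of _ "Obj K"]) (auto simp: is_nt_def)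
qed (simp_all add: assms)

lemma is_nt_id_nt:
  assumes "category K" "category L" "is_functor K L F"
  shows "is_nt K L (id_nt K L F)"
proof -
  interpret K: category K by fact
  interpret L: category L by fact
  have "amap F f \<cdot>\<^bsub>L\<^esub> Id L (omap F (Dom K f)) = Id L (omap F (Cod K f)) \<cdot>\<^bsub>L\<^esub> amap F f"
    if "f \<in> Arr K" for f
    using is_functor_hom[OF assms(3) K.Arr_hom[OF that]] by (simp add: L.Comp_Id L.Id_Comp)
  with assms show ?thesis
    by (auto simp: is_nt_def id_nt_def K.Dom_Obj K.Cod_Obj L.Id_hom is_functor_Obj)
qed

lemma is_nt_comp_nt:
  assumes "category K" "category L" and \<tau>: "is_nt K L \<tau>" and \<sigma>: "is_nt K L \<sigma>"
    and eq: "NCod \<tau> = NDom \<sigma>"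
  shows "is_nt K L (comp_nt K L \<sigma> \<tau>)"
proof -
  interpret K: category K by fact
  interpret L: category L by fact
  have \<tau>h: "cpt \<tau> x \<in> hom L (omap (NDom \<tau>) x) (omap (NDom \<sigma>) x)" if "x \<in> Obj K" for x
    using is_nt_hom[OF \<tau> that] by (simp add: eq)
  note \<sigma>h = is_nt_hom[OF \<sigma>]
  have "amap (NCod \<sigma>) f \<cdot>\<^bsub>L\<^esub> (cpt \<sigma> x \<cdot>\<^bsub>L\<^esub> cpt \<tau> x) = cpt \<sigma> y \<cdot>\<^bsub>L\<^esub> cpt \<tau> y \<cdot>\<^bsub>L\<^esub> amap (NDom \<tau>) f"
    if f: "f \<in> hom K x y" for f x y
  proof -
    have x: "x \<in> Obj K" and y: "y \<in> Obj K"
      using f K.Dom_Obj K.Cod_Obj by (auto simp: hom_def)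
    have funcs: "is_functor K L (NDom \<tau>)" "is_functor K L (NDom \<sigma>)" "is_functor K L (NCod \<sigma>)"
      using \<tau> \<sigma> by (auto simp: is_nt_def)
    note h = funcs[THEN is_functor_hom, OF f]
    \<comment> \<open>Two squares are pasted: naturality of \<open>\<sigma>\<close> is used first,
      then naturality of \<open>\<tau>\<close>, with associativity shifting the brackets in
      between.\<close>
    have "amap (NCod \<sigma>) f \<cdot>\<^bsub>L\<^esub> (cpt \<sigma> x \<cdot>\<^bsub>L\<^esub> cpt \<tau> x)
        = cpt \<sigma> y \<cdot>\<^bsub>L\<^esub> amap (NDom \<sigma>) f \<cdot>\<^bsub>L\<^esub> cpt \<tau> x"
      using is_nt_natural[OF \<sigma> f] L.Comp_assoc[OF \<tau>h[OF x] \<sigma>h[OF x] h(3)] by simp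
    also have "\<dots> = cpt \<sigma> y \<cdot>\<^bsub>L\<^esub> (cpt \<tau> y \<cdot>\<^bsub>L\<^esub> amap (NDom \<tau>) f)"
      using is_nt_natural[OF \<tau> f] L.Comp_assoc[OF \<tau>h[OF x] h(2) \<sigma>h[OF y]] by (simp add: eq)
    also have "\<dots> = cpt \<sigma> y \<cdot>\<^bsub>L\<^esub> cpt \<tau> y \<cdot>\<^bsub>L\<^esub> amap (NDom \<tau>) f"
      using L.Comp_assoc[OF h(1) \<tau>h[OF y] \<sigma>h[OF y]] .
    finally show ?thesis .
  qed
  from this[OF K.Arr_hom] show ?thesis
    using \<sigma> \<tau> L.Comp_hom[OF \<tau>h \<sigma>h]
    by (auto simp: is_nt_def comp_nt_def K.Dom_Obj K.Cod_Obj)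
qed

lemma comp_nt_assoc:
  assumes "category L" "is_nt K L \<tau>" "is_nt K L \<sigma>" "is_nt K L \<rho>"
    and "NCod \<tau> = NDom \<sigma>" "NCod \<sigma> = NDom \<rho>"
  shows "comp_nt K L \<rho> (comp_nt K L \<sigma> \<tau>) = comp_nt K L (comp_nt K L \<rho> \<sigma>) \<tau>"
proof -
  have "cpt \<rho> x \<cdot>\<^bsub>L\<^esub> (cpt \<sigma> x \<cdot>\<^bsub>L\<^esub> cpt \<tau> x) = cpt \<rho> x \<cdot>\<^bsub>L\<^esub> cpt \<sigma> x \<cdot>\<^bsub>L\<^esub> cpt \<tau> x"
    if "x \<in> Obj K" for x
    using category.Comp_assoc[OF assms(1)] assms(2-4)[THEN is_nt_hom, OF that] assms(5,6) by auto
  then show ?thesis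
    by (auto simp: comp_nt_def)
qed

lemma comp_nt_id_nt:
  assumes "category L" "is_nt K L \<tau>"
  shows "comp_nt K L \<tau> (id_nt K L (NDom \<tau>)) = \<tau>" "comp_nt K L (id_nt K L (NCod \<tau>)) \<tau> = \<tau>"
proof -
  have e: "cpt \<tau> \<in> extensional (Obj K)"
    using assms(2) by (simp add: is_nt_def)
  have "cpt \<tau> x \<cdot>\<^bsub>L\<^esub> Id L (omap (NDom \<tau>) x) = cpt \<tau> x" "Id L (omap (NCod \<tau>) x) \<cdot>\<^bsub>L\<^esub> cpt \<tau> x = cpt \<tau> x"
    if "x \<in> Obj K" for x
    using is_nt_hom[OF assms(2) that] category.Comp_Id[OF assms(1)] category.Id_Comp[OF assms(1)]
    by auto
  then show "comp_nt K L \<tau> (id_nt K L (NDom \<tau>)) = \<tau>" "comp_nt K L (id_nt K L (NCod \<tau>)) \<tau> = \<tau>"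
    by (auto intro!: nt.equality extensionalityI[OF _ e] simp: comp_nt_def id_nt_def)
qed

text \<open>The set \<open>X\<close> is kept arbitrary so that one proof serves both
  \<open>Hom\<close>, where \<open>X\<close> consists of the contextual functors, and
  \<open>func_cat\<close>.\<close>

lemma category_func_cat_on:
  assumes "category K" "category L" "\<And>F. F \<in> X \<Longrightarrow> is_functor K L F"
  shows "category (func_cat_on X K L)"
proof
  fix F assume "F \<in> Obj (func_cat_on X K L)"
  then show "Id (func_cat_on X K L) F \<in> hom (func_cat_on X K L) F F"
    using is_nt_id_nt[OF assms(1,2)] assms(3) by (auto simp: func_cat_on_def hom_def id_nt_def)
next
  fix \<tau> \<sigma> F G H
  assume "\<tau> \<in> hom (func_cat_on X K L) F G" "\<sigma> \<in> hom (func_cat_on X K L) G H"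
  then show "\<sigma> \<cdot>\<^bsub>func_cat_on X K L\<^esub> \<tau> \<in> hom (func_cat_on X K L) F H"
    using is_nt_comp_nt[OF assms(1,2), of \<tau> \<sigma>] by (auto simp: func_cat_on_def hom_def comp_nt_def)
next
  fix \<tau> \<sigma> \<rho> E F G H
  assume "\<tau> \<in> hom (func_cat_on X K L) E F" "\<sigma> \<in> hom (func_cat_on X K L) F G"
    "\<rho> \<in> hom (func_cat_on X K L) G H"
  then show "\<rho> \<cdot>\<^bsub>func_cat_on X K L\<^esub> (\<sigma> \<cdot>\<^bsub>func_cat_on X K L\<^esub> \<tau>)
      = \<rho> \<cdot>\<^bsub>func_cat_on X K L\<^esub> \<sigma> \<cdot>\<^bsub>func_cat_on X K L\<^esub> \<tau>"
    using comp_nt_assoc[OF assms(2), of K \<tau> \<sigma> \<rho>] by (auto simp: func_cat_on_def hom_def)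
qed (use comp_nt_id_nt[OF assms(2)] in \<open>auto simp: func_cat_on_def hom_def\<close>)


section \<open>Categories of contextual functors\<close>

lemma contextual_functorD:
  assumes "contextual_functor B C F"
  shows "is_functor B C F"
    and "x \<in> Obj B \<Longrightarrow> len C (omap F x) = len B x"
    and "x \<in> Obj B \<Longrightarrow> ft C (omap F x) = omap F (ft B x)"
    and "x \<in> Obj B \<Longrightarrow> len B x \<ge> 1 \<Longrightarrow> amap F (disp B x) = disp C (omap F x)"
    and "s \<in> dsq B \<Longrightarrow> map_square (amap F) s \<in> dsq C"
  using assms by (auto simp: contextual_functor_def)

text \<open>Needed because distinguished squares of diagrams are required to commute as squares of
  diagrams, besides being distinguished at each object of \<open>A\<close>.\<close>

lemma commutative_square_map:
  assumes "is_functor K L F" "commutative_square K s"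
  shows "commutative_square L (map_square (amap F) s)"
proof -
  obtain w x y z where t: "top_side s \<in> hom K w x" and l: "left_side s \<in> hom K w y"
    and r: "right_side s \<in> hom K x z" and b: "bottom_side s \<in> hom K y z"
    and eq: "right_side s \<cdot>\<^bsub>K\<^esub> top_side s = bottom_side s \<cdot>\<^bsub>K\<^esub> left_side s"
    using assms(2) by (auto simp: commutative_square_def)
  have "amap F (right_side s) \<cdot>\<^bsub>L\<^esub> amap F (top_side s)
      = amap F (bottom_side s) \<cdot>\<^bsub>L\<^esub> amap F (left_side s)"
    using is_functor_Comp[OF assms(1) t r] is_functor_Comp[OF assms(1) l b] eq by simp
  then show ?thesis
    using t l r b unfolding commutative_square_def square.map_sel
    by (blast intro: is_functor_hom[OF assms(1)])
qed

lemma commutative_square_Arr: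
  "commutative_square K s \<Longrightarrow> g \<in> set_square s \<Longrightarrow> g \<in> Arr K"
  by (cases s) (auto simp: commutative_square_def hom_def)

lemma contextual_functor_comp:
  assumes "precontextual_category B" and F: "contextual_functor B C F" and G: "contextual_functor C D G"
  shows "contextual_functor B D (comp_func B G F)"
proof -
  interpret precontextual_category B by fact
  note F' = contextual_functorD[OF F] and G' = contextual_functorD[OF G]
  have "map_square (amap (comp_func B G F)) s \<in> dsq D" if "s \<in> dsq B" for s
  proof -
    \<comment> \<open>\<open>comp_func\<close> agrees with plain composition only on arrows of
      \<open>B\<close>; the four sides are arrows because a distinguished square commutes.\<close>
    have "map_square (amap (comp_func B G F)) s = map_square (amap G) (map_square (amap F) s)"
      unfolding square.map_comp
      using commutative_square_Arr[OF dsq_commutative[OF that]]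
      by (intro square.map_cong0) (simp add: comp_func_def compose_def)
    then show ?thesis
      using F'(5) G'(5) that by simp
  qed
  moreover have "disp B x \<in> Arr B" if "x \<in> Obj B" "len B x \<ge> 1" for x
    using disp_hom[OF that] by (simp add: hom_def)
  moreover have "is_functor B D (comp_func B G F)"
    using is_functor_comp_func[OF category_axioms F'(1) G'(1)] .
  ultimately show ?thesis
    using F'(2-4) G'(2-4) is_functor_Obj[OF F'(1)] ft_Obj
    by (auto simp: contextual_functor_def) (auto simp: comp_func_def compose_def)
qed

lemma Hom_simps [simp]:
  "Obj (Hom B C) = {F. contextual_functor B C F}"
  "Arr (Hom B C) = {\<tau>. is_nt B C \<tau> \<and> contextual_functor B C (NDom \<tau>) \<and> contextual_functor B C (NCod \<tau>)}"
  "Dom (Hom B C) = NDom" "Cod (Hom B C) = NCod" "Id (Hom B C) = id_nt B C"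
  "Comp (Hom B C) = comp_nt B C"
  by (simp_all add: Hom_def func_cat_on_def)

text \<open>\<open>is_nt\<close> already contains functoriality of both ends, so the membership
  conditions of \<open>func_cat_on\<close> disappear.\<close>

lemma func_cat_simps [simp]:
  "Obj (func_cat K L) = {F. is_functor K L F}"
  "Arr (func_cat K L) = {\<tau>. is_nt K L \<tau>}"
  "Dom (func_cat K L) = NDom" "Cod (func_cat K L) = NCod" "Id (func_cat K L) = id_nt K L"
  "Comp (func_cat K L) = comp_nt K L"
  by (auto simp: func_cat_def func_cat_on_def is_nt_def)

lemma category_Hom: "category B \<Longrightarrow> category C \<Longrightarrow> category (Hom B C)"
  unfolding Hom_def by (rule category_func_cat_on) (auto dest: contextual_functorD)

lemma category_func_cat: "category K \<Longrightarrow> category L \<Longrightarrow> category (func_cat K L)"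
  unfolding func_cat_def by (rule category_func_cat_on) auto

section \<open>Whiskering, and change of the source in \<open>Hom\<close>\<close>

lemma is_nt_precomp:
  assumes "category B'" "is_functor B' B G" and \<tau>: "is_nt B C \<tau>"
  shows "is_nt B' C \<lparr>NDom = comp_func B' (NDom \<tau>) G, NCod = comp_func B' (NCod \<tau>) G,
    cpt = (\<lambda>x\<in>Obj B'. cpt \<tau> (omap G x))\<rparr>"
proof -
  interpret category B' by fact
  have "is_functor B C (NDom \<tau>)" "is_functor B C (NCod \<tau>)"
    using \<tau> by (auto simp: is_nt_def)
  then have "is_functor B' C (comp_func B' (NDom \<tau>) G)" "is_functor B' C (comp_func B' (NCod \<tau>) G)"
    using is_functor_comp_func assms(1,2) by blast+
  then show ?thesis
    using is_nt_natural[OF \<tau> is_functor_hom[OF assms(2) Arr_hom]] is_nt_hom[OF \<tau> is_functor_Obj[OF assms(2)]]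
    by (auto simp: is_nt_def comp_func_def compose_def Dom_Obj Cod_Obj)
qed

text \<open>The naturality squares are the images under \<open>P\<close> of those of
  \<open>\<tau>\<close>.\<close>

lemma is_nt_postcomp:
  assumes "category K" "is_functor L M P" and \<tau>: "is_nt K L \<tau>"
  shows "is_nt K M \<lparr>NDom = comp_func K P (NDom \<tau>), NCod = comp_func K P (NCod \<tau>),
    cpt = (\<lambda>x\<in>Obj K. amap P (cpt \<tau> x))\<rparr>"
proof -
  interpret category K by fact
  have funcs: "is_functor K L (NDom \<tau>)" "is_functor K L (NCod \<tau>)"
    using \<tau> by (auto simp: is_nt_def)
  have "amap P (amap (NCod \<tau>) f) \<cdot>\<^bsub>M\<^esub> amap P (cpt \<tau> (Dom K f))
      = amap P (cpt \<tau> (Cod K f)) \<cdot>\<^bsub>M\<^esub> amap P (amap (NDom \<tau>) f)" if f: "f \<in> Arr K" for f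
    using is_functor_Comp[OF assms(2) is_nt_hom[OF \<tau> Dom_Obj[OF f]] is_functor_hom[OF funcs(2) Arr_hom[OF f]]]
      is_functor_Comp[OF assms(2) is_functor_hom[OF funcs(1) Arr_hom[OF f]] is_nt_hom[OF \<tau> Cod_Obj[OF f]]]
      is_nt_natural[OF \<tau> Arr_hom[OF f]] by simp
  moreover have "is_functor K M (comp_func K P (NDom \<tau>))" "is_functor K M (comp_func K P (NCod \<tau>))"
    using is_functor_comp_func funcs assms(1,2) by blast+
  ultimately show ?thesis
    using is_functor_hom[OF assms(2) is_nt_hom[OF \<tau>]]
    by (auto simp: is_nt_def comp_func_def compose_def Dom_Obj Cod_Obj)
qed

text \<open>Serves twice: for \<open>G\<close> between contextual categories it is the action of
  \<open>Hom\<close> on \<open>G\<close>, and with the diagrams in the place of \<open>B\<close> it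
  makes transposes functorial. For the second use \<open>B\<close> is taken to be just a
  category.\<close>

lemma is_functor_Hom_precomp:
  assumes "precontextual_category B'" "category B" "category C" "contextual_functor B' B G"
  shows "is_functor (Hom B C) (Hom B' C) (Hom_precomp B' B C G)"
proof -
  interpret B': precontextual_category B' by fact
  have G: "is_functor B' B G"
    using assms(4) by (rule contextual_functorD)
  interpret H: category "Hom B C"
    using assms(2,3) by (rule category_Hom)
  show ?thesis
    unfolding is_functor_def
  proof (intro conjI ballI impI)
    show "amap (Hom_precomp B' B C G) \<tau> \<in> hom (Hom B' C) (omap (Hom_precomp B' B C G) (Dom (Hom B C) \<tau>))
        (omap (Hom_precomp B' B C G) (Cod (Hom B C) \<tau>))" if "\<tau> \<in> Arr (Hom B C)" for \<tau>
      using that is_nt_precomp[OF B'.category_axioms G]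
        contextual_functor_comp[OF assms(1,4)]
      by (auto simp: Hom_precomp_def hom_def)
    show "amap (Hom_precomp B' B C G) (Id (Hom B C) F) = Id (Hom B' C) (omap (Hom_precomp B' B C G) F)"
      if "F \<in> Obj (Hom B C)" for F
      using that H.Id_hom[OF that] is_functor_Obj[OF G]
      by (auto simp: Hom_precomp_def hom_def) (auto simp: id_nt_def comp_func_def compose_def)
    show "amap (Hom_precomp B' B C G) (\<sigma> \<cdot>\<^bsub>Hom B C\<^esub> \<tau>)
        = amap (Hom_precomp B' B C G) \<sigma> \<cdot>\<^bsub>Hom B' C\<^esub> amap (Hom_precomp B' B C G) \<tau>"
      if "\<tau> \<in> Arr (Hom B C)" "\<sigma> \<in> Arr (Hom B C)" "Cod (Hom B C) \<tau> = Dom (Hom B C) \<sigma>" for \<tau> \<sigma>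
      using that H.Comp_hom[of \<tau> "NDom \<tau>" "NCod \<tau>" \<sigma> "NCod \<sigma>"] is_functor_Obj[OF G]
      by (auto simp: Hom_precomp_def hom_def) (auto simp: comp_nt_def comp_func_def compose_def)
  qed (use is_nt_precomp[OF B'.category_axioms G] contextual_functor_comp[OF assms(1,4)] in
      \<open>auto simp: Hom_precomp_def\<close>)
qed

lemma Hom_precomp_simps [simp]:
  "contextual_functor B C F \<Longrightarrow> omap (Hom_precomp B' B C G) F = comp_func B' F G"
  "\<tau> \<in> Arr (Hom B C) \<Longrightarrow> amap (Hom_precomp B' B C G) \<tau> =
    \<lparr>NDom = comp_func B' (NDom \<tau>) G, NCod = comp_func B' (NCod \<tau>) G, cpt = (\<lambda>x\<in>Obj B'. cpt \<tau> (omap G x))\<rparr>"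
  by (simp_all add: Hom_precomp_def)


section \<open>Evaluation of diagrams\<close>

lemma diagram_ctx_simps [simp]:
  "Obj (diagram_ctx A C) = {Fs. diagram_seq A C Fs}"
  "(Fs, \<tau>, Gs) \<in> Arr (diagram_ctx A C) \<longleftrightarrow>
    diagram_seq A C Fs \<and> diagram_seq A C Gs \<and> is_nt A C \<tau> \<and> NDom \<tau> = last Fs \<and> NCod \<tau> = last Gs"
  "Dom (diagram_ctx A C) (Fs, \<tau>, Gs) = Fs"
  "Cod (diagram_ctx A C) (Fs, \<tau>, Gs) = Gs"
  "Id (diagram_ctx A C) Fs = (Fs, id_nt A C (last Fs), Fs)"
  "(Gs, \<sigma>, Hs) \<cdot>\<^bsub>diagram_ctx A C\<^esub> (Fs, \<tau>, Gs') = (Fs, comp_nt A C \<sigma> \<tau>, Hs)"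
  "len (diagram_ctx A C) = diagram_len"
  "ft (diagram_ctx A C) = diagram_ft"
  "disp (diagram_ctx A C) = diagram_disp A C"
  by (simp_all add: diagram_ctx_def diagram_cat_def)

lemma hom_diagram_ctx:
  "t \<in> hom (diagram_ctx A C) Fs Gs \<longleftrightarrow>
    (\<exists>\<tau>. t = (Fs, \<tau>, Gs) \<and> diagram_seq A C Fs \<and> diagram_seq A C Gs \<and> is_nt A C \<tau> \<and>
      NDom \<tau> = last Fs \<and> NCod \<tau> = last Gs)"
  by (cases t) (auto simp: hom_def)

text \<open>The definition refers to commutative squares of \<open>diagram_cat\<close>;
  \<open>diagram_ctx\<close> extends that record with the same arrows, ends and composition, so
  commutativity means the same in both.\<close>

lemma dsq_diagram_ctx:
  "s \<in> dsq (diagram_ctx A C) \<longleftrightarrow> commutative_square (diagram_ctx A C) s \<and>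
    (\<exists>Fs. diagram_seq A C Fs \<and> diagram_len Fs \<ge> 1 \<and> left_side s = diagram_disp A C Fs) \<and>
    (\<exists>Gs. diagram_seq A C Gs \<and> diagram_len Gs \<ge> 1 \<and> right_side s = diagram_disp A C Gs) \<and>
    (\<forall>a\<in>Obj A. map_square (diagram_cpt a) s \<in> dsq C)"
proof -
  have "hom (diagram_ctx A C) = hom (diagram_cat A C)"
    by (simp add: diagram_ctx_def hom_def fun_eq_iff)
  then have "commutative_square (diagram_ctx A C) s = commutative_square (diagram_cat A C) s"
    by (simp add: commutative_square_def) (simp add: diagram_ctx_def)
  then show ?thesis
    by (simp add: diagram_ctx_def) (simp add: diagram_cat_def)
qed

text \<open>The tags travel along unchanged, so each law is the corresponding law for natural
  transformations between last entries.\<close>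

lemma category_diagram_ctx:
  assumes "category A" "category C"
  shows "category (diagram_ctx A C)"
proof
  fix t assume "t \<in> Arr (diagram_ctx A C)"
  then show "Dom (diagram_ctx A C) t \<in> Obj (diagram_ctx A C)" "Cod (diagram_ctx A C) t \<in> Obj (diagram_ctx A C)"
    by (cases t; simp)+
next
  fix Fs assume "Fs \<in> Obj (diagram_ctx A C)"
  then have "diagram_seq A C Fs" "is_functor A C (last Fs)"
    by (auto simp: diagram_seq_def)
  then show "Id (diagram_ctx A C) Fs \<in> hom (diagram_ctx A C) Fs Fs"
    using is_nt_id_nt[OF assms] by (auto simp: hom_diagram_ctx) (auto simp: id_nt_def)
next
  fix t u Fs Gs Hs
  assume "t \<in> hom (diagram_ctx A C) Fs Gs" "u \<in> hom (diagram_ctx A C) Gs Hs"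
  then show "u \<cdot>\<^bsub>diagram_ctx A C\<^esub> t \<in> hom (diagram_ctx A C) Fs Hs"
    by (auto simp: hom_diagram_ctx is_nt_comp_nt[OF assms]) (auto simp: comp_nt_def)
next
  fix t Fs Gs
  assume "t \<in> hom (diagram_ctx A C) Fs Gs"
  then obtain \<tau> where \<tau>: "t = (Fs, \<tau>, Gs)" "is_nt A C \<tau>" "NDom \<tau> = last Fs" "NCod \<tau> = last Gs"
    by (auto simp: hom_diagram_ctx)
  then show "t \<cdot>\<^bsub>diagram_ctx A C\<^esub> Id (diagram_ctx A C) Fs = t" "Id (diagram_ctx A C) Gs \<cdot>\<^bsub>diagram_ctx A C\<^esub> t = t"
    using comp_nt_id_nt[OF assms(2) \<tau>(2)] by auto
next
  fix t u v Es Fs Gs Hs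
  assume "t \<in> hom (diagram_ctx A C) Es Fs" "u \<in> hom (diagram_ctx A C) Fs Gs" "v \<in> hom (diagram_ctx A C) Gs Hs"
  then show "v \<cdot>\<^bsub>diagram_ctx A C\<^esub> (u \<cdot>\<^bsub>diagram_ctx A C\<^esub> t) = v \<cdot>\<^bsub>diagram_ctx A C\<^esub> u \<cdot>\<^bsub>diagram_ctx A C\<^esub> t"
    by (auto simp: hom_diagram_ctx intro!: comp_nt_assoc[OF assms(2)])
qed

section \<open>Length zero, fathers and display maps of diagrams\<close>

lemma (in contextual_category) one_Obj: "one C \<in> Obj C"
  and len_one: "len C (one C) = 0"
  using theI'[OF ex1_len_0] by (auto simp: one_def)

lemma (in contextual_category) len_0_eq_one: "x \<in> Obj C \<Longrightarrow> len C x = 0 \<Longrightarrow> x = one C"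
  using ex1_len_0 one_Obj len_one by auto

text \<open>Used to show that a functor with constant value \<open>one C\<close> on objects is
  constant on arrows as well.\<close>

lemma (in contextual_category) hom_one: "f \<in> hom C x (one C) \<Longrightarrow> g \<in> hom C x (one C) \<Longrightarrow> f = g"
  using len_0_terminal[OF one_Obj len_one] Dom_Obj by (auto simp: terminal_def hom_def)

locale diagrams = A: category A + C: contextual_category C
  for A :: "('a, 'am) cat" and C :: "('c, 'cm) ctx"
begin

abbreviation D where "D \<equiv> diagram_ctx A C"

lemma category_D: "category D"
  by (rule category_diagram_ctx[OF A.category_axioms C.category_axioms])

lemma is_functor_last: "diagram_seq A C Fs \<Longrightarrow> is_functor A C (last Fs)"
  by (simp add: diagram_seq_def)

text \<open>Each condition in \<open>diagram_seq\<close> concerns one entry, or an entry and its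
  predecessor, hence passes to nonempty initial segments.\<close>

lemma diagram_seq_ft:
  assumes Fs: "diagram_seq A C Fs"
  shows "diagram_seq A C (diagram_ft Fs)"
proof (cases "diagram_len Fs = 0")
  case True
  with Fs show ?thesis by (simp add: diagram_ft_def)
next
  case False
  then have "butlast Fs \<noteq> []" "0 < length (butlast Fs)"
    by (auto simp: diagram_len_def simp flip: length_0_conv)
  moreover have "is_functor A C F" if "F \<in> set (butlast Fs)" for F
    using Fs in_set_butlastD[OF that] by (simp add: diagram_seq_def)
  moreover have "butlast Fs ! i = Fs ! i \<and> i < length Fs" if "i < length (butlast Fs)" for i
    using that nth_butlast[OF that] by simp
  ultimately have "diagram_seq A C (butlast Fs)"
    using Fs unfolding diagram_seq_def
    by (metis (no_types, lifting) less_imp_diff_less)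
  with False show ?thesis by (simp add: diagram_ft_def)
qed

text \<open>A diagram of length n is a list of n + 1 entries, so after truncation the last index is
  n - 1, that is \<open>length Fs - 2\<close>.\<close>

lemma last_diagram_ft: "diagram_len Fs \<ge> 1 \<Longrightarrow> last (diagram_ft Fs) = Fs ! (length Fs - 2)"
  by (cases Fs rule: rev_cases)
    (auto simp: diagram_ft_def diagram_len_def last_conv_nth nth_append)

lemma diagram_seq_zero:
  "diagram_seq A C Fs \<Longrightarrow> diagram_len Fs = 0 \<Longrightarrow> Fs = [const_func A C (one C)]"
  by (cases Fs) (auto simp: diagram_seq_def diagram_len_def)

text \<open>This is why evaluation preserves lengths and fathers. For length zero the conditions on
  indices from 1 on say nothing; there the entry is constant at \<open>one C\<close>, which is its
  own father.\<close>

lemma diagram_seq_last: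
  assumes Fs: "diagram_seq A C Fs" and a: "a \<in> Obj A"
  shows "len C (omap (last Fs) a) = diagram_len Fs"
    and "ft C (omap (last Fs) a) = omap (last (diagram_ft Fs)) a"
proof -
  have "len C (omap (last Fs) a) = diagram_len Fs \<and> ft C (omap (last Fs) a) = omap (last (diagram_ft Fs)) a"
  proof (cases "diagram_len Fs = 0")
    case True
    with diagram_seq_zero[OF Fs True] a show ?thesis
      using C.ft_len_0[OF C.one_Obj C.len_one]
      by (simp add: diagram_len_def diagram_ft_def const_func_def C.len_one)
  next
    case False
    then have "last Fs = Fs ! diagram_len Fs" "diagram_len Fs < length Fs"
        "length Fs - 2 = diagram_len Fs - 1"
      using Fs by (auto simp: diagram_seq_def diagram_len_def last_conv_nth)
    with Fs a False last_diagram_ft[of Fs] show ?thesis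
      by (simp add: diagram_seq_def)
  qed
  then show "len C (omap (last Fs) a) = diagram_len Fs"
    "ft C (omap (last Fs) a) = omap (last (diagram_ft Fs)) a" by auto
qed

lemma is_nt_disp_nt:
  assumes Fs: "diagram_seq A C Fs" and "diagram_len Fs \<ge> 1"
  shows "is_nt A C (disp_nt A C (last Fs) (last (diagram_ft Fs)))"
proof -
  have "last Fs = Fs ! diagram_len Fs" "diagram_len Fs < length Fs"
    "length Fs - 2 = diagram_len Fs - 1"
    using assms by (auto simp: diagram_seq_def diagram_len_def last_conv_nth)
  with assms last_diagram_ft[of Fs] show ?thesis
    by (simp add: diagram_seq_def)
qed

lemma diagram_disp_hom:
  "diagram_seq A C Fs \<Longrightarrow> diagram_len Fs \<ge> 1 \<Longrightarrow> diagram_disp A C Fs \<in> hom D Fs (diagram_ft Fs)"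
  using is_nt_disp_nt diagram_seq_ft by (auto simp: hom_diagram_ctx diagram_disp_def disp_nt_def)

section \<open>Evaluation at objects and along arrows of \<open>A\<close>\<close>

definition eval_at :: "'a \<Rightarrow> (('a, 'am, 'c, 'cm) func list, ('a, 'am, 'c, 'cm) diagram_arr, 'c, 'cm) func" where
  "eval_at a = \<lparr>omap = (\<lambda>Fs\<in>Obj D. omap (last Fs) a), amap = (\<lambda>t\<in>Arr D. diagram_cpt a t)\<rparr>"

definition eval_along ::
  "'am \<Rightarrow> (('a, 'am, 'c, 'cm) func list, ('a, 'am, 'c, 'cm) diagram_arr, 'c, 'cm) nt" where
  "eval_along f = \<lparr>NDom = eval_at (Dom A f), NCod = eval_at (Cod A f), cpt = (\<lambda>Fs\<in>Obj D. amap (last Fs) f)\<rparr>"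

definition evaluation where
  "evaluation = \<lparr>omap = (\<lambda>a\<in>Obj A. eval_at a), amap = (\<lambda>f\<in>Arr A. eval_along f)\<rparr>"

lemma is_functor_eval_at:
  assumes a: "a \<in> Obj A"
  shows "is_functor D C (eval_at a)"
proof -
  interpret D: category D by (rule category_D)
  have h: "diagram_cpt a t \<in> hom C (omap (last Fs) a) (omap (last Gs) a)" if "t \<in> hom D Fs Gs" for t Fs Gs
    using that is_nt_hom[OF _ a] by (fastforce simp: hom_diagram_ctx diagram_cpt_def)
  show ?thesis
    unfolding is_functor_def
  proof (intro conjI ballI impI)
    show "omap (eval_at a) \<in> Obj D \<rightarrow>\<^sub>E Obj C"
      using is_functor_Obj[OF is_functor_last a] by (auto simp: eval_at_def)
    show "amap (eval_at a) \<in> Arr D \<rightarrow>\<^sub>E Arr C"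
      using h[OF D.Arr_hom] by (auto simp: eval_at_def hom_def)
    show "amap (eval_at a) t \<in> hom C (omap (eval_at a) (Dom D t)) (omap (eval_at a) (Cod D t))"
      if "t \<in> Arr D" for t
      using that h[OF D.Arr_hom[OF that]] D.Dom_Obj D.Cod_Obj by (auto simp: eval_at_def)
    show "amap (eval_at a) (Id D Fs) = Id C (omap (eval_at a) Fs)" if "Fs \<in> Obj D" for Fs
      using that D.Id_hom[OF that] a by (auto simp: eval_at_def hom_def diagram_cpt_def) (auto simp: id_nt_def)
    show "amap (eval_at a) (u \<cdot>\<^bsub>D\<^esub> t) = amap (eval_at a) u \<cdot>\<^bsub>C\<^esub> amap (eval_at a) t"
      if "t \<in> Arr D" "u \<in> Arr D" "Cod D t = Dom D u" for t u
    proof -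
      have "u \<cdot>\<^bsub>D\<^esub> t \<in> Arr D"
        using D.Comp_hom[of t "Dom D t" "Dom D u" u "Cod D u"] that by (simp add: hom_def)
      moreover have "diagram_cpt a (u \<cdot>\<^bsub>D\<^esub> t) = diagram_cpt a u \<cdot>\<^bsub>C\<^esub> diagram_cpt a t"
        using a by (cases t; cases u) (simp add: diagram_cpt_def comp_nt_def)
      ultimately show ?thesis
        using that by (simp add: eval_at_def)
    qed
  qed
qed

text \<open>Display maps and distinguished squares of diagrams are defined through their components,
  so evaluation preserves them by construction.\<close>

lemma contextual_functor_eval_at:
  assumes a: "a \<in> Obj A"
  shows "contextual_functor D C (eval_at a)"
proof -
  have "map_square (amap (eval_at a)) s \<in> dsq C" if "s \<in> dsq D" for s
  proof -
    have "map_square (amap (eval_at a)) s = map_square (diagram_cpt a) s"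
      using commutative_square_Arr[of D s] that
      by (intro square.map_cong0) (auto simp: eval_at_def dsq_diagram_ctx)
    then show ?thesis
      using that a by (simp add: dsq_diagram_ctx)
  qed
  moreover have "amap (eval_at a) (diagram_disp A C Fs) = disp C (omap (eval_at a) Fs)"
    if "diagram_seq A C Fs" "diagram_len Fs \<ge> 1" for Fs
    using diagram_disp_hom[OF that] that a
    by (auto simp: eval_at_def hom_def) (auto simp: diagram_disp_def diagram_cpt_def disp_nt_def)
  ultimately show ?thesis
    using is_functor_eval_at[OF a] diagram_seq_last[OF _ a] diagram_seq_ft
    by (auto simp: contextual_functor_def) (auto simp: eval_at_def)
qed

text \<open>At an arrow of diagrams the required square is the naturality square, at
  \<open>f\<close>, of the transformation which that arrow carries.\<close>

lemma is_nt_eval_along: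
  assumes f: "f \<in> Arr A"
  shows "is_nt D C (eval_along f)"
proof -
  interpret D: category D by (rule category_D)
  have "amap (last Fs) f \<in> hom C (omap (last Fs) (Dom A f)) (omap (last Fs) (Cod A f))"
    if "diagram_seq A C Fs" for Fs
    using is_functor_hom[OF is_functor_last[OF that] A.Arr_hom[OF f]] .
  moreover have "amap (last (Cod D t)) f \<cdot>\<^bsub>C\<^esub> diagram_cpt (Dom A f) t
      = diagram_cpt (Cod A f) t \<cdot>\<^bsub>C\<^esub> amap (last (Dom D t)) f" if "t \<in> Arr D" for t
    using that is_nt_natural[OF _ A.Arr_hom[OF f], of C]
    by (cases t) (force simp: diagram_cpt_def)
  ultimately show ?thesis
    using is_functor_eval_at f D.Dom_Obj D.Cod_Obj
    unfolding is_nt_def[of D]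
    by (auto simp: eval_along_def A.Dom_Obj A.Cod_Obj) (auto simp: eval_at_def)
qed

lemma eval_along_Arr: "f \<in> Arr A \<Longrightarrow> eval_along f \<in> Arr (Hom D C)"
  using is_nt_eval_along contextual_functor_eval_at
  by (simp add: A.Dom_Obj A.Cod_Obj) (simp add: eval_along_def A.Dom_Obj A.Cod_Obj)

text \<open>Functoriality in \<open>A\<close> is, at each diagram, functoriality of its last
  entry.\<close>

lemma is_functor_evaluation: "is_functor A (Hom D C) evaluation"
  unfolding is_functor_def
proof (intro conjI ballI impI)
  show "amap evaluation f \<in> hom (Hom D C) (omap evaluation (Dom A f)) (omap evaluation (Cod A f))"
    if "f \<in> Arr A" for f
    using eval_along_Arr[OF that] that
    by (simp add: evaluation_def hom_def A.Dom_Obj A.Cod_Obj) (simp add: eval_along_def)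
  show "amap evaluation (Id A a) = Id (Hom D C) (omap evaluation a)" if "a \<in> Obj A" for a
    using A.Id_hom[OF that] that is_functor_Id[OF is_functor_last that]
    by (auto simp: evaluation_def hom_def eval_along_def id_nt_def eval_at_def)
  show "amap evaluation (g \<cdot>\<^bsub>A\<^esub> f) = amap evaluation g \<cdot>\<^bsub>Hom D C\<^esub> amap evaluation f"
    if "f \<in> Arr A" "g \<in> Arr A" "Cod A f = Dom A g" for f g
  proof -
    have fg: "f \<in> hom A (Dom A f) (Dom A g)" "g \<in> hom A (Dom A g) (Cod A g)"
      using that by (auto simp: hom_def)
    show ?thesis
      using A.Comp_hom[OF fg] that is_functor_Comp[OF is_functor_last fg]
      by (auto simp: evaluation_def hom_def eval_along_def comp_nt_def)
  qed
qed (use eval_along_Arr contextual_functor_eval_at in \<open>auto simp: evaluation_def\<close>)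


section \<open>Transposition\<close>

definition transpose where
  "transpose B \<Phi> = comp_func A (Hom_precomp B D C \<Phi>) evaluation"

text \<open>The whiskering of \<open>\<theta>\<close> with evaluation at \<open>a\<close>, in the
  form produced by \<open>is_nt_postcomp\<close>.\<close>

definition transpose_cpt where
  "transpose_cpt B \<theta> a = \<lparr>NDom = comp_func B (eval_at a) (NDom \<theta>),
     NCod = comp_func B (eval_at a) (NCod \<theta>), cpt = (\<lambda>x\<in>Obj B. amap (eval_at a) (cpt \<theta> x))\<rparr>"

definition transpose_nt where
  "transpose_nt B \<theta> = \<lparr>NDom = transpose B (NDom \<theta>), NCod = transpose B (NCod \<theta>),
     cpt = (\<lambda>a\<in>Obj A. transpose_cpt B \<theta> a)\<rparr>"

definition transposition where
  "transposition B = \<lparr>omap = (\<lambda>\<Phi>\<in>Obj (Hom B D). transpose B \<Phi>),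
     amap = (\<lambda>\<theta>\<in>Arr (Hom B D). transpose_nt B \<theta>)\<rparr>"

lemma omap_transpose: "a \<in> Obj A \<Longrightarrow> omap (transpose B \<Phi>) a = comp_func B (eval_at a) \<Phi>"
  using contextual_functor_eval_at[of a]
  by (simp add: transpose_def comp_func_def[of A] evaluation_def compose_def)

lemma amap_transpose: "f \<in> Arr A \<Longrightarrow> amap (transpose B \<Phi>) f =
  \<lparr>NDom = comp_func B (eval_at (Dom A f)) \<Phi>, NCod = comp_func B (eval_at (Cod A f)) \<Phi>,
   cpt = (\<lambda>x\<in>Obj B. cpt (eval_along f) (omap \<Phi> x))\<rparr>"
  using eval_along_Arr[of f]
  by (simp add: transpose_def comp_func_def[of A] evaluation_def compose_def)
    (simp add: eval_along_def)

end

section \<open>Functoriality of transposition\<close>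

locale diagrams_from = diagrams A C + B: contextual_category B
  for A :: "('a, 'am) cat" and C :: "('c, 'cm) ctx" and B :: "('b, 'bm) ctx"
begin

lemma eval_last:
  assumes "contextual_functor B D \<Phi>" "x \<in> Obj B"
  shows "a \<in> Obj A \<Longrightarrow> omap (eval_at a) (omap \<Phi> x) = omap (last (omap \<Phi> x)) a"
    and "f \<in> Arr A \<Longrightarrow> cpt (eval_along f) (omap \<Phi> x) = amap (last (omap \<Phi> x)) f"
  using is_functor_Obj[OF contextual_functorD(1)[OF assms(1)] assms(2)]
  by (auto simp: eval_at_def eval_along_def)

lemma is_functor_transpose:
  assumes "contextual_functor B D \<Phi>"
  shows "is_functor A (Hom B C) (transpose B \<Phi>)"
  unfolding transpose_def
  by (rule is_functor_comp_func[OF A.category_axioms is_functor_evaluation is_functor_Hom_precomp[OF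
        B.precontextual_category_axioms category_D C.category_axioms assms]])

lemma transpose_cpt_Arr:
  assumes "\<theta> \<in> Arr (Hom B D)" "a \<in> Obj A"
  shows "transpose_cpt B \<theta> a \<in> Arr (Hom B C)"
  using is_nt_postcomp[OF B.category_axioms is_functor_eval_at[OF assms(2)], of \<theta>] assms
    contextual_functor_comp[OF B.precontextual_category_axioms _ contextual_functor_eval_at[OF assms(2)]]
  by (auto simp: transpose_cpt_def)

lemma is_nt_transpose_nt:
  assumes \<theta>: "\<theta> \<in> Arr (Hom B D)"
  shows "is_nt A (Hom B C) (transpose_nt B \<theta>)"
proof -
  have \<theta>': "is_nt B D \<theta>" "contextual_functor B D (NDom \<theta>)" "contextual_functor B D (NCod \<theta>)"
    using \<theta> by auto
  \<comment> \<open>Interchange of the two directions: this is naturality of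
    \<open>eval_along f\<close> at the arrow \<open>cpt \<theta> x\<close> of diagrams.\<close>
  have nat: "cpt (eval_along f) (omap (NCod \<theta>) x) \<cdot>\<^bsub>C\<^esub> amap (eval_at (Dom A f)) (cpt \<theta> x)
      = amap (eval_at (Cod A f)) (cpt \<theta> x) \<cdot>\<^bsub>C\<^esub> cpt (eval_along f) (omap (NDom \<theta>) x)"
    if f: "f \<in> Arr A" and x: "x \<in> Obj B" for f x
    using is_nt_natural[OF is_nt_eval_along[OF f] is_nt_hom[OF \<theta>'(1) x]]
    by (simp add: eval_along_def)
  have "amap (transpose B (NCod \<theta>)) f \<cdot>\<^bsub>Hom B C\<^esub> transpose_cpt B \<theta> (Dom A f)
      = transpose_cpt B \<theta> (Cod A f) \<cdot>\<^bsub>Hom B C\<^esub> amap (transpose B (NDom \<theta>)) f" if "f \<in> Arr A" for f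
    using nat[OF that] that
    by (auto simp: amap_transpose transpose_cpt_def comp_nt_def)
  moreover have "transpose_cpt B \<theta> a \<in> hom (Hom B C) (omap (transpose B (NDom \<theta>)) a) (omap (transpose B (NCod \<theta>)) a)"
    if "a \<in> Obj A" for a
    using transpose_cpt_Arr[OF \<theta> that] that
    by (simp add: hom_def omap_transpose) (simp add: transpose_cpt_def)
  ultimately show ?thesis
    using is_functor_transpose \<theta>'
    by (auto simp: is_nt_def transpose_nt_def A.Dom_Obj A.Cod_Obj)
qed

lemma is_functor_transposition: "is_functor (Hom B D) (func_cat A (Hom B C)) (transposition B)"
proof -
  interpret H: category "Hom B D"
    by (rule category_Hom[OF B.category_axioms category_D])
  show ?thesis
    unfolding is_functor_def
  proof (intro conjI ballI impI)
    show "amap (transposition B) \<theta> \<in> hom (func_cat A (Hom B C))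
        (omap (transposition B) (Dom (Hom B D) \<theta>)) (omap (transposition B) (Cod (Hom B D) \<theta>))"
      if "\<theta> \<in> Arr (Hom B D)" for \<theta>
      using is_nt_transpose_nt[OF that] that
      by (simp add: transposition_def hom_def) (simp add: transpose_nt_def)
    show "amap (transposition B) (Id (Hom B D) \<Phi>) = Id (func_cat A (Hom B C)) (omap (transposition B) \<Phi>)"
      if \<Phi>: "\<Phi> \<in> Obj (Hom B D)" for \<Phi>
    proof -
      \<comment> \<open>The simplification rule for identities of \<open>D\<close> is switched off
        here and below, since it would turn \<open>Id D\<close> into an explicit triple to which
        this equation no longer applies.\<close>
      have "amap (eval_at a) (Id D (omap \<Phi> x)) = Id C (omap (eval_at a) (omap \<Phi> x))"
        if "x \<in> Obj B" "a \<in> Obj A" for x a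
        using is_functor_Id[OF is_functor_eval_at[OF that(2)] is_functor_Obj[OF contextual_functorD(1) that(1)]] \<Phi>
        by (simp del: diagram_ctx_simps(5))
      then show ?thesis
        using H.Id_hom[OF \<Phi>] \<Phi>
        by (auto simp: transposition_def hom_def simp del: diagram_ctx_simps(5))
          (auto simp: transpose_nt_def id_nt_def[of B] id_nt_def[of A "Hom B C"] transpose_cpt_def omap_transpose comp_func_def compose_def
            intro!: restrict_ext simp del: diagram_ctx_simps(5))
    qed
    show "amap (transposition B) (\<eta> \<cdot>\<^bsub>Hom B D\<^esub> \<theta>) = amap (transposition B) \<eta> \<cdot>\<^bsub>func_cat A (Hom B C)\<^esub> amap (transposition B) \<theta>"
      if "\<theta> \<in> Arr (Hom B D)" "\<eta> \<in> Arr (Hom B D)" "Cod (Hom B D) \<theta> = Dom (Hom B D) \<eta>" for \<theta> \<eta>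
    proof -
      have \<theta>\<eta>: "is_nt B D \<theta>" "is_nt B D \<eta>" "NCod \<theta> = NDom \<eta>"
        using that by auto
      have "amap (eval_at a) (cpt \<eta> x \<cdot>\<^bsub>D\<^esub> cpt \<theta> x) = amap (eval_at a) (cpt \<eta> x) \<cdot>\<^bsub>C\<^esub> amap (eval_at a) (cpt \<theta> x)"
        if "x \<in> Obj B" "a \<in> Obj A" for x a
      proof (rule is_functor_Comp[OF is_functor_eval_at[OF that(2)]])
        show "cpt \<theta> x \<in> hom D (omap (NDom \<theta>) x) (omap (NDom \<eta>) x)"
          using is_nt_hom[OF \<theta>\<eta>(1) that(1)] by (simp only: \<theta>\<eta>(3))
        show "cpt \<eta> x \<in> hom D (omap (NDom \<eta>) x) (omap (NCod \<eta>) x)"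
          by (rule is_nt_hom[OF \<theta>\<eta>(2) that(1)])
      qed
      then have "transpose_cpt B (comp_nt B D \<eta> \<theta>) a = comp_nt B C (transpose_cpt B \<eta> a) (transpose_cpt B \<theta> a)"
        if "a \<in> Obj A" for a
        using that by (simp add: transpose_cpt_def comp_nt_def cong: restrict_cong)
      then have "transpose_nt B (comp_nt B D \<eta> \<theta>) = comp_nt A (Hom B C) (transpose_nt B \<eta>) (transpose_nt B \<theta>)"
        by (simp add: transpose_nt_def comp_nt_def[of B D] comp_nt_def[of A] cong: restrict_cong)
      moreover have "comp_nt B D \<eta> \<theta> \<in> Arr (Hom B D)"
        using is_nt_comp_nt[OF B.category_axioms category_D \<theta>\<eta>] that
        by (simp add: comp_nt_def[of B D \<eta> \<theta>])
      ultimately show ?thesis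
        using that(1,2) by (simp add: transposition_def del: Hom_simps(2))
    qed
  qed (use is_nt_transpose_nt is_functor_transpose in \<open>auto simp: transposition_def\<close>)
qed

section \<open>Slices of a functor into \<open>Hom\<close>\<close>

lemma diagram_seq_Nil: "is_functor A C (const_func A C (one C)) \<Longrightarrow> diagram_seq A C [const_func A C (one C)]"
  by (simp add: diagram_seq_def)

text \<open>Fathers truncate at the end, so diagrams are grown there; the new index is
  \<open>length Fs\<close>, which is also the length of the extended diagram.\<close>

lemma diagram_seq_snoc:
  assumes Fs: "diagram_seq A C Fs" and "is_functor A C F"
    and "\<And>a. a \<in> Obj A \<Longrightarrow> len C (omap F a) = length Fs \<and> ft C (omap F a) = omap (last Fs) a"
    and "is_nt A C (disp_nt A C F (last Fs))"
  shows "diagram_seq A C (Fs @ [F])"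
proof -
  have ne: "Fs \<noteq> []"
    using Fs by (simp add: diagram_seq_def)
  have "(\<forall>a\<in>Obj A. len C (omap ((Fs @ [F]) ! i) a) = i \<and>
           ft C (omap ((Fs @ [F]) ! i) a) = omap ((Fs @ [F]) ! (i - 1)) a) \<and>
        is_nt A C (disp_nt A C ((Fs @ [F]) ! i) ((Fs @ [F]) ! (i - 1)))"
    if "1 \<le> i" "i < length (Fs @ [F])" for i
  proof (cases "i < length Fs")
    case True
    then have "(Fs @ [F]) ! i = Fs ! i" "(Fs @ [F]) ! (i - 1) = Fs ! (i - 1)"
      by (auto simp: nth_append)
    with True Fs that(1) show ?thesis
      by (simp add: diagram_seq_def)
  next
    case False
    with that have "i = length Fs" by simp
    moreover from this ne have "(Fs @ [F]) ! i = F" "(Fs @ [F]) ! (i - 1) = last Fs"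
      by (auto simp: nth_append last_conv_nth)
    ultimately show ?thesis using assms(3,4) by simp
  qed
  moreover have "(Fs @ [F]) ! 0 = Fs ! 0"
    using ne by (simp add: nth_append)
  ultimately show ?thesis
    using Fs assms(2) ne unfolding diagram_seq_def by simp
qed

definition slice where
  "slice H x = \<lparr>omap = (\<lambda>a\<in>Obj A. omap (omap H a) x), amap = (\<lambda>f\<in>Arr A. cpt (amap H f) x)\<rparr>"

definition slice_nt where
  "slice_nt H g = \<lparr>NDom = slice H (Dom B g), NCod = slice H (Cod B g), cpt = (\<lambda>a\<in>Obj A. amap (omap H a) g)\<rparr>"

text \<open>The father is iterated \<open>len B x - i\<close> times to reach length
  \<open>i\<close>, so that entry \<open>i\<close> takes values of length \<open>i\<close> and the
  last entry is the slice at \<open>x\<close> itself.\<close>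

definition slices where
  "slices H x = map (\<lambda>i. slice H ((ft B ^^ (len B x - i)) x)) [0..<Suc (len B x)]"

definition untranspose where
  "untranspose H = \<lparr>omap = (\<lambda>x\<in>Obj B. slices H x),
     amap = (\<lambda>g\<in>Arr B. (slices H (Dom B g), slice_nt H g, slices H (Cod B g)))\<rparr>"

definition untranspose_cpt where
  "untranspose_cpt \<eta> x = \<lparr>NDom = slice (NDom \<eta>) x, NCod = slice (NCod \<eta>) x,
     cpt = (\<lambda>a\<in>Obj A. cpt (cpt \<eta> a) x)\<rparr>"

definition untranspose_nt where
  "untranspose_nt \<eta> = \<lparr>NDom = untranspose (NDom \<eta>), NCod = untranspose (NCod \<eta>),
     cpt = (\<lambda>x\<in>Obj B. (slices (NDom \<eta>) x, untranspose_cpt \<eta> x, slices (NCod \<eta>) x))\<rparr>"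

lemma slices_0: "len B x = 0 \<Longrightarrow> slices H x = [slice H x]"
  by (simp add: slices_def)

lemma slices_ft:
  assumes "x \<in> Obj B" "len B x \<ge> 1"
  shows "slices H x = slices H (ft B x) @ [slice H x]"
proof -
  obtain n where n: "len B x = Suc n" "len B (ft B x) = n"
    using assms B.len_ft[OF assms] by (cases "len B x") auto
  \<comment> \<open>For \<open>i\<close> at most \<open>n\<close> the subtraction does not truncate,
    so one application of \<open>ft B\<close> splits off and is moved innermost.\<close>
  have "(ft B ^^ (Suc n - i)) x = (ft B ^^ (n - i)) (ft B x)" if "i < Suc n" for i
    using that by (simp add: Suc_diff_le funpow_swap1)
  then have "map (\<lambda>i. slice H ((ft B ^^ (Suc n - i)) x)) [0..<Suc n]
      = map (\<lambda>i. slice H ((ft B ^^ (n - i)) (ft B x))) [0..<Suc n]"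
    by (intro map_cong) auto
  then show ?thesis
    by (simp add: slices_def n)
qed

lemma last_slices: "last (slices H x) = slice H x"
  by (simp add: slices_def)

lemma diagram_len_slices: "diagram_len (slices H x) = len B x"
  by (simp add: slices_def diagram_len_def)

lemma diagram_ft_slices:
  assumes "x \<in> Obj B"
  shows "diagram_ft (slices H x) = slices H (ft B x)"
proof (cases "len B x = 0")
  case True
  then show ?thesis
    using B.ft_len_0[OF assms] by (simp add: diagram_ft_def diagram_len_slices)
next
  case False
  then have "diagram_ft (slices H x) = butlast (slices H x)"
    by (simp add: diagram_ft_def diagram_len_slices)
  with False show ?thesis
    by (simp add: slices_ft[OF assms])
qed

lemma func_Hom_Obj: "is_functor A (Hom B C) H \<Longrightarrow> a \<in> Obj A \<Longrightarrow> contextual_functor B C (omap H a)"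
  using is_functor_Obj[of A "Hom B C" H a] by simp

lemma func_Hom_Arr:
  assumes "is_functor A (Hom B C) H" "f \<in> Arr A"
  shows "is_nt B C (amap H f)" "NDom (amap H f) = omap H (Dom A f)" "NCod (amap H f) = omap H (Cod A f)"
  using is_functor_hom[OF assms(1) A.Arr_hom[OF assms(2)]] by (auto simp: hom_def)

text \<open>The functor laws of \<open>H\<close> are equations between natural transformations;
  their components at \<open>x\<close> are the laws of the slice.\<close>

lemma is_functor_slice:
  assumes H: "is_functor A (Hom B C) H" and x: "x \<in> Obj B"
  shows "is_functor A C (slice H x)"
proof -
  have h: "cpt (amap H f) x \<in> hom C (omap (omap H (Dom A f)) x) (omap (omap H (Cod A f)) x)" if "f \<in> Arr A" for f
    using is_nt_hom[OF func_Hom_Arr(1)[OF H that] x] by (simp add: func_Hom_Arr[OF H that])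
  show ?thesis
    unfolding is_functor_def
  proof (intro conjI ballI impI)
    show "omap (slice H x) \<in> Obj A \<rightarrow>\<^sub>E Obj C"
      using is_functor_Obj[OF contextual_functorD(1)[OF func_Hom_Obj[OF H]] x] by (auto simp: slice_def)
    show "amap (slice H x) \<in> Arr A \<rightarrow>\<^sub>E Arr C"
      using h by (auto simp: slice_def hom_def)
    show "amap (slice H x) f \<in> hom C (omap (slice H x) (Dom A f)) (omap (slice H x) (Cod A f))"
      if "f \<in> Arr A" for f
      using h[OF that] that by (simp add: slice_def A.Dom_Obj A.Cod_Obj)
    show "amap (slice H x) (Id A a) = Id C (omap (slice H x) a)" if "a \<in> Obj A" for a
      using A.Id_hom[OF that] that x is_functor_Id[OF H that]
      by (simp add: slice_def hom_def id_nt_def)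
    show "amap (slice H x) (g \<cdot>\<^bsub>A\<^esub> f) = amap (slice H x) g \<cdot>\<^bsub>C\<^esub> amap (slice H x) f"
      if "f \<in> Arr A" "g \<in> Arr A" "Cod A f = Dom A g" for f g
    proof -
      have fg: "f \<in> hom A (Dom A f) (Dom A g)" "g \<in> hom A (Dom A g) (Cod A g)"
        using that by (auto simp: hom_def)
      show ?thesis
        using A.Comp_hom[OF fg] that x is_functor_Comp[OF H fg]
        by (simp add: slice_def hom_def comp_nt_def)
    qed
  qed
qed

text \<open>The square for \<open>f\<close> is the naturality square of \<open>amap H f\<close> at
  \<open>g\<close>, with the roles of \<open>f\<close> and \<open>g\<close> exchanged.\<close>

lemma is_nt_slice_nt:
  assumes H: "is_functor A (Hom B C) H" and g: "g \<in> Arr B"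
  shows "is_nt A C (slice_nt H g)"
proof -
  have "cpt (amap H f) (Cod B g) \<cdot>\<^bsub>C\<^esub> amap (omap H (Dom A f)) g
      = amap (omap H (Cod A f)) g \<cdot>\<^bsub>C\<^esub> cpt (amap H f) (Dom B g)" if "f \<in> Arr A" for f
    using is_nt_natural[OF func_Hom_Arr(1)[OF H that] B.Arr_hom[OF g]]
    by (simp add: func_Hom_Arr[OF H that])
  then show ?thesis
    using is_functor_slice[OF H B.Dom_Obj[OF g]] is_functor_slice[OF H B.Cod_Obj[OF g]]
      is_functor_hom[OF contextual_functorD(1)[OF func_Hom_Obj[OF H]] B.Arr_hom[OF g]]
    unfolding is_nt_def
    by (simp add: slice_nt_def A.Dom_Obj A.Cod_Obj) (simp add: slice_def A.Dom_Obj A.Cod_Obj)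
qed

text \<open>Each \<open>omap H a\<close> preserves display maps, so the display maps between slices
  are induced by the single arrow \<open>disp B x\<close>. Their naturality then comes from
  \<open>is_nt_slice_nt\<close>.\<close>

lemma disp_nt_slice:
  assumes H: "is_functor A (Hom B C) H" and x: "x \<in> Obj B" "len B x \<ge> 1"
  shows "disp_nt A C (slice H x) (slice H (ft B x)) = slice_nt H (disp B x)"
  using B.disp_hom[OF x] contextual_functorD(4)[OF func_Hom_Obj[OF H] x]
  by (auto simp: disp_nt_def slice_nt_def hom_def) (auto simp: slice_def)

text \<open>Preservation of length settles the values on objects, and terminality of
  \<open>one C\<close> those on arrows. \<open>diagram_seq\<close> asks for this exact functor as
  first entry.\<close>

lemma slice_len_0:
  assumes H: "is_functor A (Hom B C) H" and x: "x \<in> Obj B" "len B x = 0"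
  shows "slice H x = const_func A C (one C)"
proof -
  have o: "omap (omap H a) x = one C" if "a \<in> Obj A" for a
    using contextual_functorD(1,2)[OF func_Hom_Obj[OF H that]] x
    by (auto intro!: C.len_0_eq_one dest: is_functor_Obj)
  moreover have "cpt (amap H f) x = Id C (one C)" if "f \<in> Arr A" for f
    using is_nt_hom[OF func_Hom_Arr(1)[OF H that] x(1)] that C.Id_hom[OF C.one_Obj]
    by (intro C.hom_one[of _ "one C"]) (auto simp: func_Hom_Arr[OF H that] o A.Dom_Obj A.Cod_Obj)
  ultimately show ?thesis
    by (auto simp: slice_def const_func_def)
qed

lemma diagram_seq_slices:
  assumes H: "is_functor A (Hom B C) H" and "x \<in> Obj B"
  shows "diagram_seq A C (slices H x)"
  using assms(2)
proof (induction "len B x" arbitrary: x)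
  case 0
  then show ?case
    using slices_0[of x H] slice_len_0[OF H] is_functor_slice[OF H, of x] by (simp add: diagram_seq_Nil)
next
  case (Suc n)
  then have x: "x \<in> Obj B" "len B x \<ge> 1" by auto
  have "diagram_seq A C (slices H (ft B x))"
    using Suc B.len_ft[OF x] B.ft_Obj by simp
  \<comment> \<open>The list for \<open>ft B x\<close> has one entry more than the length of
    \<open>ft B x\<close>, hence exactly \<open>len B x\<close> entries.\<close>
  moreover have "len C (omap (slice H x) a) = length (slices H (ft B x)) \<and>
      ft C (omap (slice H x) a) = omap (slice H (ft B x)) a" if "a \<in> Obj A" for a
    using contextual_functorD(2,3)[OF func_Hom_Obj[OF H that]] that x B.len_ft[OF x]
    by (simp add: slice_def slices_def)
  moreover have "is_nt A C (disp_nt A C (slice H x) (slice H (ft B x)))"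
    using is_nt_slice_nt[OF H] B.disp_hom[OF x] by (simp add: disp_nt_slice[OF H x] hom_def)
  ultimately show ?case
    using is_functor_slice[OF H x(1)] by (simp add: slices_ft[OF x] diagram_seq_snoc last_slices)
qed

section \<open>Untransposition\<close>

lemma amap_untranspose_hom:
  assumes H: "is_functor A (Hom B C) H" and g: "g \<in> Arr B"
  shows "amap (untranspose H) g \<in> hom D (slices H (Dom B g)) (slices H (Cod B g))"
  using is_nt_slice_nt[OF H g] diagram_seq_slices[OF H] g
  by (auto simp: hom_diagram_ctx untranspose_def last_slices B.Dom_Obj B.Cod_Obj) (auto simp: slice_nt_def)

lemma is_functor_untranspose:
  assumes H: "is_functor A (Hom B C) H"
  shows "is_functor B D (untranspose H)"
  unfolding is_functor_def
proof (intro conjI ballI impI)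
  note H' = contextual_functorD(1)[OF func_Hom_Obj[OF H]]
  show "omap (untranspose H) \<in> Obj B \<rightarrow>\<^sub>E Obj D"
    using diagram_seq_slices[OF H] by (auto simp: untranspose_def)
  have "amap (untranspose H) \<in> extensional (Arr B)"
    by (simp add: untranspose_def)
  then show "amap (untranspose H) \<in> Arr B \<rightarrow>\<^sub>E Arr D"
    using amap_untranspose_hom[OF H] by (auto simp: hom_def PiE_def)
  show "amap (untranspose H) g \<in> hom D (omap (untranspose H) (Dom B g)) (omap (untranspose H) (Cod B g))"
    if "g \<in> Arr B" for g
    using amap_untranspose_hom[OF H that] that by (simp add: untranspose_def B.Dom_Obj B.Cod_Obj)
  show "amap (untranspose H) (Id B x) = Id D (omap (untranspose H) x)" if "x \<in> Obj B" for x
    using B.Id_hom[OF that] that is_functor_Id[OF H' that]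
    by (auto simp: untranspose_def hom_def last_slices slice_nt_def id_nt_def) (auto simp: slice_def)
  show "amap (untranspose H) (g \<cdot>\<^bsub>B\<^esub> f) = amap (untranspose H) g \<cdot>\<^bsub>D\<^esub> amap (untranspose H) f"
    if "f \<in> Arr B" "g \<in> Arr B" "Cod B f = Dom B g" for f g
  proof -
    have fg: "f \<in> hom B (Dom B f) (Dom B g)" "g \<in> hom B (Dom B g) (Cod B g)"
      using that by (auto simp: hom_def)
    show ?thesis
      using B.Comp_hom[OF fg] that is_functor_Comp[OF H' fg]
      by (auto simp: untranspose_def hom_def slice_nt_def comp_nt_def)
  qed
qed

text \<open>On arrows, the component at \<open>a\<close> of the untranspose is
  \<open>omap H a\<close>, which is contextual; therefore images of distinguished squares are
  distinguished at each object of \<open>A\<close>.\<close>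

lemma contextual_functor_untranspose:
  assumes H: "is_functor A (Hom B C) H"
  shows "contextual_functor B D (untranspose H)"
proof -
  have disp: "amap (untranspose H) (disp B x) = diagram_disp A C (slices H x)"
    if "x \<in> Obj B" "len B x \<ge> 1" for x
    using B.disp_hom[OF that] disp_nt_slice[OF H that] that
    by (auto simp: untranspose_def diagram_disp_def hom_def last_slices diagram_ft_slices)
  have "map_square (amap (untranspose H)) s \<in> dsq D" if s: "s \<in> dsq B" for s
  proof -
    have "map_square (diagram_cpt a) (map_square (amap (untranspose H)) s) \<in> dsq C" if "a \<in> Obj A" for a
    proof -
      have "map_square (diagram_cpt a) (map_square (amap (untranspose H)) s) = map_square (amap (omap H a)) s"
        unfolding square.map_comp
        using commutative_square_Arr[OF B.dsq_commutative[OF s]] that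
        by (intro square.map_cong0) (simp add: untranspose_def slice_nt_def diagram_cpt_def)
      then show ?thesis
        using contextual_functorD(5)[OF func_Hom_Obj[OF H that] s] by simp
    qed
    moreover have "commutative_square D (map_square (amap (untranspose H)) s)"
      using commutative_square_map[OF is_functor_untranspose[OF H] B.dsq_commutative[OF s]] .
    moreover obtain x y where x: "x \<in> Obj B" "len B x \<ge> 1" "left_side s = disp B x"
      and y: "y \<in> Obj B" "len B y \<ge> 1" "right_side s = disp B y"
      using B.dsq_left[OF s] B.dsq_right[OF s] by blast
    then have "\<exists>Fs. diagram_seq A C Fs \<and> diagram_len Fs \<ge> 1 \<and>
        left_side (map_square (amap (untranspose H)) s) = diagram_disp A C Fs"
      "\<exists>Fs. diagram_seq A C Fs \<and> diagram_len Fs \<ge> 1 \<and>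
        right_side (map_square (amap (untranspose H)) s) = diagram_disp A C Fs"
      using diagram_seq_slices[OF H] disp diagram_len_slices unfolding square.map_sel by metis+
    ultimately show ?thesis
      unfolding dsq_diagram_ctx by blast
  qed
  then show ?thesis
    using is_functor_untranspose[OF H] disp
    by (auto simp: contextual_functor_def)
      (auto simp: untranspose_def diagram_len_slices diagram_ft_slices B.ft_Obj)
qed

lemma is_nt_untranspose_cpt:
  assumes \<eta>: "is_nt A (Hom B C) \<eta>" and x: "x \<in> Obj B"
  shows "is_nt A C (untranspose_cpt \<eta> x)"
proof -
  have H: "is_functor A (Hom B C) (NDom \<eta>)" "is_functor A (Hom B C) (NCod \<eta>)"
    using \<eta> by (auto simp: is_nt_def)
  have "cpt (cpt \<eta> a) x \<in> hom C (omap (omap (NDom \<eta>) a) x) (omap (omap (NCod \<eta>) a) x)" if "a \<in> Obj A" for a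
    using is_nt_hom[OF \<eta> that] is_nt_hom[OF _ x, of C "cpt \<eta> a"] by (auto simp: hom_def)
  moreover have "cpt (amap (NCod \<eta>) f) x \<cdot>\<^bsub>C\<^esub> cpt (cpt \<eta> (Dom A f)) x
      = cpt (cpt \<eta> (Cod A f)) x \<cdot>\<^bsub>C\<^esub> cpt (amap (NDom \<eta>) f) x" if "f \<in> Arr A" for f
    \<comment> \<open>Naturality of \<open>\<eta>\<close> is an equation between arrows of
      \<open>Hom B C\<close>; its component at \<open>x\<close> is the equation needed in
      \<open>C\<close>.\<close>
    using arg_cong[OF is_nt_natural[OF \<eta> A.Arr_hom[OF that]], of "\<lambda>\<tau>. cpt \<tau> x"] x
    by (simp add: comp_nt_def)
  ultimately show ?thesis
    using is_functor_slice[OF H(1) x] is_functor_slice[OF H(2) x]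
    unfolding is_nt_def
    by (simp add: untranspose_cpt_def A.Dom_Obj A.Cod_Obj) (simp add: slice_def)
qed

lemma untranspose_nt_Arr:
  assumes \<eta>: "is_nt A (Hom B C) \<eta>"
  shows "untranspose_nt \<eta> \<in> Arr (Hom B D)"
proof -
  have H: "is_functor A (Hom B C) (NDom \<eta>)" "is_functor A (Hom B C) (NCod \<eta>)"
    using \<eta> by (auto simp: is_nt_def)
  have c: "is_nt B C (cpt \<eta> a)" "NDom (cpt \<eta> a) = omap (NDom \<eta>) a" "NCod (cpt \<eta> a) = omap (NCod \<eta>) a"
    if "a \<in> Obj A" for a
    using is_nt_hom[OF \<eta> that] by (auto simp: hom_def)
  have "(slices (NDom \<eta>) x, untranspose_cpt \<eta> x, slices (NCod \<eta>) x)
      \<in> hom D (slices (NDom \<eta>) x) (slices (NCod \<eta>) x)" if "x \<in> Obj B" for x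
    using diagram_seq_slices[OF H(1) that] diagram_seq_slices[OF H(2) that] is_nt_untranspose_cpt[OF \<eta> that]
    by (auto simp: hom_diagram_ctx last_slices untranspose_cpt_def)
  \<comment> \<open>At each \<open>a\<close> this is naturality of \<open>cpt \<eta> a\<close> at
    \<open>g\<close>.\<close>
  moreover have "comp_nt A C (slice_nt (NCod \<eta>) g) (untranspose_cpt \<eta> (Dom B g))
      = comp_nt A C (untranspose_cpt \<eta> (Cod B g)) (slice_nt (NDom \<eta>) g)" if "g \<in> Arr B" for g
    using is_nt_natural[OF c(1) B.Arr_hom[OF that]] c(2,3)
    by (auto simp: comp_nt_def slice_nt_def untranspose_cpt_def)
  ultimately have "is_nt B D (untranspose_nt \<eta>)"
    using is_functor_untranspose[OF H(1)] is_functor_untranspose[OF H(2)]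
    unfolding is_nt_def
    by (simp add: untranspose_nt_def B.Dom_Obj B.Cod_Obj) (simp add: untranspose_def B.Dom_Obj B.Cod_Obj)
  then show ?thesis
    using contextual_functor_untranspose H by (simp add: untranspose_nt_def)
qed

section \<open>The two constructions are mutually inverse\<close>

lemma transpose_untranspose:
  assumes H: "is_functor A (Hom B C) H"
  shows "transpose B (untranspose H) = H"
proof (rule func_eqI)
  note U = contextual_functor_untranspose[OF H]
  show "is_functor A (Hom B C) (transpose B (untranspose H))"
    by (rule is_functor_transpose[OF U])
  \<comment> \<open>Evaluation reads only the last entry of a diagram, and the last entry of
    \<open>slices H x\<close> is the slice at \<open>x\<close>, whose value at \<open>a\<close> is
    that of \<open>omap H a\<close> at \<open>x\<close>.\<close>
  have o: "comp_func B (eval_at a) (untranspose H) = omap H a" if a: "a \<in> Obj A" for a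
  proof (rule func_eqI)
    show "is_functor B C (comp_func B (eval_at a) (untranspose H))"
      by (rule is_functor_comp_func[OF B.category_axioms contextual_functorD(1)[OF U] is_functor_eval_at[OF a]])
    show "is_functor B C (omap H a)"
      using contextual_functorD(1)[OF func_Hom_Obj[OF H a]] .
    show "omap (comp_func B (eval_at a) (untranspose H)) x = omap (omap H a) x" if "x \<in> Obj B" for x
      using that a diagram_seq_slices[OF H that]
      by (simp add: comp_func_def compose_def eval_at_def untranspose_def last_slices slice_def)
    show "amap (comp_func B (eval_at a) (untranspose H)) g = amap (omap H a) g" if "g \<in> Arr B" for g
      using that a amap_untranspose_hom[OF H that]
      by (simp add: comp_func_def compose_def eval_at_def hom_def)
        (simp add: untranspose_def diagram_cpt_def slice_nt_def)
  qed
  show "omap (transpose B (untranspose H)) a = omap H a" if "a \<in> Obj A" for a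
    using o[OF that] by (simp add: omap_transpose[OF that])
  show "amap (transpose B (untranspose H)) f = amap H f" if f: "f \<in> Arr A" for f
  proof (rule nt_eqI)
    show "is_nt B C (amap (transpose B (untranspose H)) f)"
      using func_Hom_Arr(1)[OF is_functor_transpose[OF U] f] .
    show "is_nt B C (amap H f)" "NDom (amap (transpose B (untranspose H)) f) = NDom (amap H f)"
      "NCod (amap (transpose B (untranspose H)) f) = NCod (amap H f)"
      using func_Hom_Arr[OF H f] o f by (simp_all add: amap_transpose A.Dom_Obj A.Cod_Obj)
    show "cpt (amap (transpose B (untranspose H)) f) x = cpt (amap H f) x" if x: "x \<in> Obj B" for x
      using eval_last(2)[OF U x f] f x
      by (simp add: amap_transpose) (simp add: untranspose_def last_slices slice_def)
  qed
qed (fact H)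

text \<open>Holding \<open>x\<close> fixed undoes the evaluations: over all of \<open>A\<close> they
  list the values of the last entry, on objects through \<open>eval_at\<close> and on arrows through
  \<open>eval_along\<close>.\<close>

lemma slice_transpose:
  assumes \<Phi>: "contextual_functor B D \<Phi>" and x: "x \<in> Obj B"
  shows "slice (transpose B \<Phi>) x = last (omap \<Phi> x)"
proof (rule func_eqI)
  show "is_functor A C (slice (transpose B \<Phi>) x)"
    by (rule is_functor_slice[OF is_functor_transpose[OF \<Phi>] x])
  show "is_functor A C (last (omap \<Phi> x))"
    using is_functor_Obj[OF contextual_functorD(1)[OF \<Phi>] x] by (simp add: is_functor_last)
qed (simp_all add: slice_def omap_transpose amap_transpose eval_last[OF \<Phi> x] x comp_func_def compose_def)

text \<open>The last entry comes from \<open>slice_transpose\<close>, the earlier ones by induction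
  along fathers. A diagram of length zero has a single entry, so nothing else remains there.\<close>

lemma slices_transpose:
  assumes \<Phi>: "contextual_functor B D \<Phi>" and "x \<in> Obj B"
  shows "slices (transpose B \<Phi>) x = omap \<Phi> x"
  using assms(2)
proof (induction "len B x" arbitrary: x)
  note \<Phi>' = contextual_functorD[OF \<Phi>]
  case 0
  then have "diagram_seq A C (omap \<Phi> x)" "diagram_len (omap \<Phi> x) = 0"
    using is_functor_Obj[OF \<Phi>'(1)] \<Phi>'(2) by auto
  then show ?case
    using slice_transpose[OF \<Phi>, of x] 0 diagram_seq_zero[of "omap \<Phi> x"] by (simp add: slices_0)
next
  note \<Phi>' = contextual_functorD[OF \<Phi>]
  case (Suc n)
  then have x: "x \<in> Obj B" "len B x \<ge> 1" by auto
  have "slices (transpose B \<Phi>) (ft B x) = omap \<Phi> (ft B x)"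
    using Suc B.len_ft[OF x] B.ft_Obj by simp
  also have "\<dots> = butlast (omap \<Phi> x)"
    using \<Phi>'(2,3)[OF x(1)] x by (simp add: diagram_ft_def)
  finally show ?case
    using is_functor_Obj[OF \<Phi>'(1) x(1)]
    by (simp add: slices_ft[OF x] slice_transpose[OF \<Phi> x(1)] diagram_seq_def)
qed

lemma untranspose_transpose:
  assumes \<Phi>: "contextual_functor B D \<Phi>"
  shows "untranspose (transpose B \<Phi>) = \<Phi>"
proof (rule func_eqI)
  note T = is_functor_transpose[OF \<Phi>]
  show "is_functor B D (untranspose (transpose B \<Phi>))" "is_functor B D \<Phi>"
    using is_functor_untranspose[OF T] contextual_functorD(1)[OF \<Phi>] .
  show "omap (untranspose (transpose B \<Phi>)) x = omap \<Phi> x" if "x \<in> Obj B" for x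
    using slices_transpose[OF \<Phi> that] that by (simp add: untranspose_def)
  show "amap (untranspose (transpose B \<Phi>)) g = amap \<Phi> g" if g: "g \<in> Arr B" for g
  proof -
    \<comment> \<open>The tags are forced by source and target, which leaves only the middle
      component to compare.\<close>
    obtain \<tau> where \<tau>: "amap \<Phi> g = (omap \<Phi> (Dom B g), \<tau>, omap \<Phi> (Cod B g))" "is_nt A C \<tau>"
      "NDom \<tau> = last (omap \<Phi> (Dom B g))" "NCod \<tau> = last (omap \<Phi> (Cod B g))"
      using is_functor_hom[OF contextual_functorD(1)[OF \<Phi>] B.Arr_hom[OF g]]
      by (auto simp: hom_diagram_ctx)
    have "amap \<Phi> g \<in> Arr D"
      by (rule is_functor_Arr[OF contextual_functorD(1)[OF \<Phi>] g])
    then have "slice_nt (transpose B \<Phi>) g = \<tau>"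
      using g \<tau> by (intro nt_eqI[OF is_nt_slice_nt[OF T g] \<tau>(2)])
        (simp_all add: slice_nt_def slice_transpose[OF \<Phi>] B.Dom_Obj B.Cod_Obj omap_transpose
          comp_func_def compose_def eval_at_def diagram_cpt_def del: diagram_ctx_simps(2))
    then show ?thesis
      using g \<tau>(1) by (simp add: untranspose_def slices_transpose[OF \<Phi>] B.Dom_Obj B.Cod_Obj)
  qed
qed

lemma transpose_untranspose_nt:
  assumes \<eta>: "is_nt A (Hom B C) \<eta>"
  shows "transpose_nt B (untranspose_nt \<eta>) = \<eta>"
proof (rule nt_eqI)
  have H: "is_functor A (Hom B C) (NDom \<eta>)" "is_functor A (Hom B C) (NCod \<eta>)"
    using \<eta> by (auto simp: is_nt_def)
  have U: "is_nt B D (untranspose_nt \<eta>)"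
    using untranspose_nt_Arr[OF \<eta>] by simp
  show "is_nt A (Hom B C) (transpose_nt B (untranspose_nt \<eta>))"
    by (rule is_nt_transpose_nt[OF untranspose_nt_Arr[OF \<eta>]])
  show nd: "NDom (transpose_nt B (untranspose_nt \<eta>)) = NDom \<eta>" "NCod (transpose_nt B (untranspose_nt \<eta>)) = NCod \<eta>"
    by (simp_all add: transpose_nt_def untranspose_nt_def transpose_untranspose[OF H(1)] transpose_untranspose[OF H(2)])
  show "cpt (transpose_nt B (untranspose_nt \<eta>)) a = cpt \<eta> a" if a: "a \<in> Obj A" for a
  proof (rule nt_eqI)
    have c: "cpt (transpose_nt B (untranspose_nt \<eta>)) a = transpose_cpt B (untranspose_nt \<eta>) a"
      using a by (simp add: transpose_nt_def)
    show "is_nt B C (cpt (transpose_nt B (untranspose_nt \<eta>)) a)"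
      using transpose_cpt_Arr[OF untranspose_nt_Arr[OF \<eta>] a] by (simp add: c)
    \<comment> \<open>The ends of \<open>transpose_cpt\<close> are values at \<open>a\<close> of
      transposes of untransposed functors; folding them back with \<open>omap_transpose\<close> lets
      the inverse law for functors finish.\<close>
    show "is_nt B C (cpt \<eta> a)" "NDom (cpt (transpose_nt B (untranspose_nt \<eta>)) a) = NDom (cpt \<eta> a)"
      "NCod (cpt (transpose_nt B (untranspose_nt \<eta>)) a) = NCod (cpt \<eta> a)"
      using is_nt_hom[OF \<eta> a] transpose_untranspose[OF H(1)] transpose_untranspose[OF H(2)]
      by (simp_all add: c hom_def) (simp_all add: transpose_cpt_def untranspose_nt_def flip: omap_transpose[OF a])
    show "cpt (cpt (transpose_nt B (untranspose_nt \<eta>)) a) x = cpt (cpt \<eta> a) x" if x: "x \<in> Obj B" for x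
    proof -
      have "cpt (untranspose_nt \<eta>) x \<in> Arr D"
        using is_nt_hom[OF U x] by (simp add: hom_def)
      then show ?thesis
        using x a by (simp add: c transpose_cpt_def eval_at_def)
          (simp add: untranspose_nt_def untranspose_cpt_def diagram_cpt_def)
    qed
  qed
qed (fact \<eta>)

lemma untranspose_transpose_nt:
  assumes \<theta>: "\<theta> \<in> Arr (Hom B D)"
  shows "untranspose_nt (transpose_nt B \<theta>) = \<theta>"
proof (rule nt_eqI)
  have \<theta>': "is_nt B D \<theta>" "contextual_functor B D (NDom \<theta>)" "contextual_functor B D (NCod \<theta>)"
    using \<theta> by auto
  note T = is_nt_transpose_nt[OF \<theta>]
  show "is_nt B D (untranspose_nt (transpose_nt B \<theta>))"
    using untranspose_nt_Arr[OF T] by simp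
  show "NDom (untranspose_nt (transpose_nt B \<theta>)) = NDom \<theta>" "NCod (untranspose_nt (transpose_nt B \<theta>)) = NCod \<theta>"
    by (simp_all add: untranspose_nt_def transpose_nt_def untranspose_transpose \<theta>')
  show "cpt (untranspose_nt (transpose_nt B \<theta>)) x = cpt \<theta> x" if x: "x \<in> Obj B" for x
  proof -
    obtain \<tau> where \<tau>: "cpt \<theta> x = (omap (NDom \<theta>) x, \<tau>, omap (NCod \<theta>) x)" "is_nt A C \<tau>"
      "NDom \<tau> = last (omap (NDom \<theta>) x)" "NCod \<tau> = last (omap (NCod \<theta>) x)"
      using is_nt_hom[OF \<theta>'(1) x] by (auto simp: hom_diagram_ctx)
    have "cpt \<theta> x \<in> Arr D"
      using is_nt_hom[OF \<theta>'(1) x] by (simp add: hom_def)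
    \<comment> \<open>As for arrows of \<open>B\<close>, the tags of \<open>cpt \<theta> x\<close>
      are already known, and the components of \<open>\<tau>\<close> are its evaluations.\<close>
    then have "untranspose_cpt (transpose_nt B \<theta>) x = \<tau>"
      using x \<tau> by (intro nt_eqI[OF is_nt_untranspose_cpt[OF T x] \<tau>(2)])
        (simp_all add: untranspose_cpt_def transpose_nt_def slice_transpose \<theta>' transpose_cpt_def
          eval_at_def diagram_cpt_def del: diagram_ctx_simps(2))
    then show ?thesis
      using x \<tau>(1) by (simp add: untranspose_nt_def) (simp add: transpose_nt_def slices_transpose \<theta>')
  qed
qed (use \<theta> in simp)

text \<open>The inverse maps are \<open>untranspose\<close> on objects and
  \<open>untranspose_nt\<close> on arrows; \<open>cat_isoI\<close> supplies their
  functoriality.\<close>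

lemma cat_iso_transposition: "cat_iso (Hom B D) (func_cat A (Hom B C)) (transposition B)"
proof (rule cat_isoI)
  show "category (Hom B D)" "category (func_cat A (Hom B C))"
    using category_Hom category_func_cat A.category_axioms B.category_axioms C.category_axioms category_D
    by blast+
  show "is_functor (Hom B D) (func_cat A (Hom B C)) (transposition B)"
    by (rule is_functor_transposition)
  fix H assume "H \<in> Obj (func_cat A (Hom B C))"
  then show "untranspose H \<in> Obj (Hom B D)" "omap (transposition B) (untranspose H) = H"
    using contextual_functor_untranspose transpose_untranspose by (auto simp: transposition_def)
next
  fix \<Phi> assume "\<Phi> \<in> Obj (Hom B D)"
  then show "untranspose (omap (transposition B) \<Phi>) = \<Phi>"
    using untranspose_transpose by (auto simp: transposition_def)
next
  fix \<eta> assume "\<eta> \<in> Arr (func_cat A (Hom B C))"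
  then have \<eta>: "is_nt A (Hom B C) \<eta>" by simp
  show "untranspose_nt \<eta> \<in> Arr (Hom B D)" "amap (transposition B) (untranspose_nt \<eta>) = \<eta>"
    using untranspose_nt_Arr[OF \<eta>] transpose_untranspose_nt[OF \<eta>] by (simp_all add: transposition_def)
next
  fix \<theta> assume "\<theta> \<in> Arr (Hom B D)"
  then show "untranspose_nt (amap (transposition B) \<theta>) = \<theta>"
    using untranspose_transpose_nt by (simp add: transposition_def)
qed

end

section \<open>Naturality in \<open>B\<close>\<close>

lemma comp_func_assoc:
  assumes "is_functor K L F"
  shows "comp_func K H (comp_func K G F) = comp_func K (comp_func L H G) F"
  \<comment> \<open>\<open>comp_func L H G\<close> is restricted to \<open>L\<close>, so
    \<open>F\<close> must be known to take its values there.\<close>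
  using is_functor_Obj[OF assms] is_functor_Arr[OF assms]
  by (auto simp: comp_func_def compose_def)

text \<open>\<open>G\<close> acts by composition on the source side and evaluation by composition on
  the target side, so the two ways around differ only in bracketing.\<close>

lemma (in diagrams) transposition_natural:
  fixes B B' :: "('b, 'bm) ctx"
  assumes "contextual_category B" "contextual_category B'" and G: "contextual_functor B' B G"
  shows "comp_func (Hom B D) (transposition B') (Hom_precomp B' B D G) =
    comp_func (Hom B D) (postcomp A (Hom B C) (Hom_precomp B' B C G)) (transposition B)"
proof -
  interpret B: diagrams_from A C B
    using assms(1) by (simp add: diagrams_from_def diagrams_axioms)
  interpret B': diagrams_from A C B'
    using assms(2) by (simp add: diagrams_from_def diagrams_axioms)
  have G': "is_functor B' B G"
    by (rule contextual_functorD(1)[OF G])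
  note obj = is_functor_Obj[OF is_functor_Hom_precomp[OF B'.B.precontextual_category_axioms
        B.B.category_axioms category_D G], simplified]
  note arr = is_functor_Arr[OF is_functor_Hom_precomp[OF B'.B.precontextual_category_axioms
        B.B.category_axioms category_D G]]
  have o: "transpose B' (comp_func B' \<Phi> G) = comp_func A (Hom_precomp B' B C G) (transpose B \<Phi>)"
    if \<Phi>: "contextual_functor B D \<Phi>" for \<Phi>
  proof (rule func_eqI)
    have \<Phi>G: "contextual_functor B' D (comp_func B' \<Phi> G)"
      by (rule contextual_functor_comp[OF B'.B.precontextual_category_axioms G \<Phi>])
    note T = B.is_functor_transpose[OF \<Phi>]
    show "is_functor A (Hom B' C) (transpose B' (comp_func B' \<Phi> G))"
      by (rule B'.is_functor_transpose[OF \<Phi>G])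
    show "is_functor A (Hom B' C) (comp_func A (Hom_precomp B' B C G) (transpose B \<Phi>))"
      by (rule is_functor_comp_func[OF A.category_axioms T is_functor_Hom_precomp[OF
          B'.B.precontextual_category_axioms B.B.category_axioms C.category_axioms G]])
    show "omap (transpose B' (comp_func B' \<Phi> G)) a = omap (comp_func A (Hom_precomp B' B C G) (transpose B \<Phi>)) a"
      if "a \<in> Obj A" for a
      using B.func_Hom_Obj[OF T that] that
      by (simp add: comp_func_def[of A] compose_def omap_transpose comp_func_assoc[OF G'])
    show "amap (transpose B' (comp_func B' \<Phi> G)) f = amap (comp_func A (Hom_precomp B' B C G) (transpose B \<Phi>)) f"
      if "f \<in> Arr A" for f
    proof -
      have "omap (comp_func B' \<Phi> G) x = omap \<Phi> (omap G x)" if "x \<in> Obj B'" for x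
        using that by (simp add: comp_func_def compose_def)
      then show ?thesis
        using is_functor_Arr[OF T that] that is_functor_Obj[OF G']
        by (simp add: comp_func_def[of A] compose_def)
          (auto simp: amap_transpose comp_func_assoc[OF G'])
    qed
  qed
  have "omap (transposition B') (omap (Hom_precomp B' B D G) \<Phi>) =
      omap (postcomp A (Hom B C) (Hom_precomp B' B C G)) (omap (transposition B) \<Phi>)"
    if "\<Phi> \<in> Obj (Hom B D)" for \<Phi>
    using that o obj B.is_functor_transpose by (simp add: transposition_def postcomp_def)
  moreover have "amap (transposition B') (amap (Hom_precomp B' B D G) \<theta>) =
      amap (postcomp A (Hom B C) (Hom_precomp B' B C G)) (amap (transposition B) \<theta>)"
    if \<theta>: "\<theta> \<in> Arr (Hom B D)" for \<theta>
  proof -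
    have \<theta>': "contextual_functor B D (NDom \<theta>)" "contextual_functor B D (NCod \<theta>)"
      using \<theta> by auto
    \<comment> \<open>Both sides have as component at \<open>x\<close> the evaluation at
      \<open>a\<close> of \<open>cpt \<theta> (omap G x)\<close>; their ends agree by
      associativity.\<close>
    have "amap (Hom_precomp B' B C G) (transpose_cpt B \<theta> a) = transpose_cpt B' (amap (Hom_precomp B' B D G) \<theta>) a"
      if "a \<in> Obj A" for a
      using Hom_precomp_simps(2)[OF B.transpose_cpt_Arr[OF \<theta> that], of B' G] Hom_precomp_simps(2)[OF \<theta>, of B' G]
        is_functor_Obj[OF G']
      by (auto simp: transpose_cpt_def comp_func_assoc[OF G'])
    moreover have "amap (transposition B') (amap (Hom_precomp B' B D G) \<theta>) = transpose_nt B' (amap (Hom_precomp B' B D G) \<theta>)"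
      using arr[OF \<theta>] by (simp add: transposition_def)
    moreover have "amap (postcomp A (Hom B C) (Hom_precomp B' B C G)) (amap (transposition B) \<theta>) =
      \<lparr>NDom = comp_func A (Hom_precomp B' B C G) (transpose B (NDom \<theta>)),
       NCod = comp_func A (Hom_precomp B' B C G) (transpose B (NCod \<theta>)),
       cpt = (\<lambda>a\<in>Obj A. amap (Hom_precomp B' B C G) (transpose_cpt B \<theta> a))\<rparr>"
      using \<theta> B.is_nt_transpose_nt[OF \<theta>] by (simp add: transposition_def postcomp_def)
        (auto simp: transpose_nt_def)
    ultimately show ?thesis
      using Hom_precomp_simps(2)[OF \<theta>, of B' G] o \<theta>' by (auto simp: transpose_nt_def)
  qed
  ultimately show ?thesis
    by (auto simp: comp_func_def compose_def fun_eq_iff restrict_def)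
qed

theorem proposition3p16:
  fixes A :: "('a, 'am) cat" and C :: "('c, 'cm) ctx"
  assumes "category A" and "contextual_category C"
  shows "\<exists>\<Phi> :: ('b, 'bm) ctx \<Rightarrow> _.
    (\<forall>B. contextual_category B \<longrightarrow>
       cat_iso (Hom B (diagram_ctx A C)) (func_cat A (Hom B C)) (\<Phi> B)) \<and>
    (\<forall>B B' G. contextual_category B \<and> contextual_category B' \<and> contextual_functor B' B G \<longrightarrow>
       comp_func (Hom B (diagram_ctx A C)) (\<Phi> B') (Hom_precomp B' B (diagram_ctx A C) G) =
       comp_func (Hom B (diagram_ctx A C)) (postcomp A (Hom B C) (Hom_precomp B' B C G)) (\<Phi> B))"
proof -
  interpret diagrams A C
    using assms by (simp add: diagrams_def)
  have "cat_iso (Hom B D) (func_cat A (Hom B C)) (transposition B)"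
    if "contextual_category B" for B :: "('b, 'bm) ctx"
    using diagrams_from.cat_iso_transposition[of A C B] that
    by (simp add: diagrams_from_def diagrams_axioms)
  then show ?thesis
    \<comment> \<open>\<open>transposition\<close> is given by one formula for all \<open>B\<close>,
      so it is itself the family required.\<close>
    using transposition_natural by (intro exI[of _ transposition]) blast
qed

end
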